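(* Let $R$ be a Lie conformal superalgebra with $\lambda$-bracket $[\cdot_\lambda\cdot]$, let $M$ be a conformal module of $R$, and let $\rho: r\mapsto\rho(r)_\lambda$ be the corresponding representation. On the $\mathbb{Z}_2$-graded $\mathbb{C}[\partial]$-module $R\oplus M$, where $(R\oplus M)_\theta=R_\theta\oplus M_\theta$ for $\theta\in\mathbb{Z}_2$ and $\partial(r+m)=\partial r+\partial m$, define $$[(r+m)_\lambda(r'+m')]_M=[r_\lambda r']+\rho(r)_\lambda m'-(-1)^{|r'||m|}\rho(r')_{-\partial-\lambda}m,\qquad r+m,\ r'+m'\in R\oplus M .$$ Then $R\oplus M$ with the $\lambda$-bracket $[\cdot_\lambda\cdot]_M$ is a Lie conformal superalgebra (called the semidirect product of $R$ and $M$ and denoted $R\ltimes M$).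
   Context: Everything is over $\mathbb{C}$. Degrees $|a|$ lie in $\mathbb{Z}_2$; whenever $|a|$ occurs, $a$ is homogeneous (so for a homogeneous $r+m\in R\oplus M$, $r$ and $m$ have the same degree), and formulas are extended linearly. All $\mathbb{Z}_2$-graded $\mathbb{C}[\partial]$-modules are finitely generated. A Lie conformal superalgebra is a $\mathbb{Z}_2$-graded $\mathbb{C}[\partial]$-module $R=R_{\bar0}\oplus R_{\bar1}$ with a $\mathbb{C}$-bilinear map $R\times R\to R[\lambda]$, $(a,b)\mapsto[a_\lambda b]$ (the $\lambda$-bracket), compatible with the grading, such that (C1) $[(\partial a)_\lambda b]=-\lambda[a_\lambda b]$; (C2) $[a_\lambda b]=-(-1)^{|a||b|}[b_{-\partial-\lambda}a]$; (C3) $[a_\lambda[b_\mu c]]=[[a_\lambda b]_{\lambda+\mu}c]+(-1)^{|a||b|}[b_\mu[a_\lambda c]]$. Brackets and maps are extended linearly over polynomials in the formal variables. An expression with subscript involving $-\partial$, e.g. $[b_{-\partial-\lambda}a]$ or $\rho(r)_{-\partial-\lambda}m$, means: write $[b_\nu a]=\sum_n \nu^n c_n$ (resp. $\rho(r)_\nu m=\sum_n\nu^n c_n$) and replace by $\sum_n(-\partial-\lambda)^n c_n$, with $\partial$ acting on the coefficients $c_n$. A conformal linear map of degree $\theta$ between $\mathbb{Z}_2$-graded $\mathbb{C}[\partial]$-modules $M\to N$ is a $\mathbb{C}$-linear map $f_\lambda:M\to N[\lambda]$ with $f_\lambda\partial=(\partial+\lambda)f_\lambda$ and $f_\lambda(M_\mu)\subseteq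 N_{\mu+\theta}[\lambda]$; $\mathrm{Chom}(M,N)$ is the sum of the spaces of such maps of degree $\bar0$ and $\bar1$, and $\mathrm{Cend}(M)=\mathrm{Chom}(M,M)$. A conformal module $M$ of $R$ is a $\mathbb{Z}_2$-graded $\mathbb{C}[\partial]$-module with a representation $\rho:R\to\mathrm{Cend}(M)$, i.e. a degree-preserving linear map $r\mapsto\rho(r)=\rho(r)_\lambda$ with $\rho(\partial a)_\lambda=-\lambda\rho(a)_\lambda$ and $\rho(a)_\lambda\rho(b)_\mu-(-1)^{|a||b|}\rho(b)_\mu\rho(a)_\lambda=\rho([a_\lambda b])_{\lambda+\mu}$. *)

theory Defs
  imports
    Complex_Main
    "HOL-Library.Z2"
    "HOL-Library.Product_Plus"
    "HOL-Computational_Algebra.Polynomial"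
begin

text \<open>
  Degrees lie in \<^typ>\<open>bit\<close>, the field with two elements. For an abelian group \<open>V\<close>,
  the type \<open>V poly\<close> serves as \<open>V[\<lambda>]\<close> and \<open>V poly poly\<close> as \<open>V[\<lambda>, \<mu>]\<close>, where \<open>\<mu>\<close> is the
  outer variable and \<open>\<lambda>\<close> the inner one.
\<close>

definition pscale :: "(complex \<Rightarrow> 'v \<Rightarrow> 'v) \<Rightarrow> complex \<Rightarrow> 'v::ab_group_add poly \<Rightarrow> 'v poly" where
  "pscale scale c = map_poly (scale c)"

text \<open>\<open>p = \<Sum>\<^sub>n \<nu>\<^sup>n c\<^sub>n\<close> is sent to \<open>\<Sum>\<^sub>n \<Phi>\<^sup>n (f c\<^sub>n)\<close>: replace the variable by the operator \<open>\<Phi>\<close> and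
  apply \<open>f\<close> to the coefficients.\<close>

definition psubst :: "('w \<Rightarrow> 'w) \<Rightarrow> ('v \<Rightarrow> 'w) \<Rightarrow> 'v::ab_group_add poly \<Rightarrow> 'w::ab_group_add" where
  "psubst \<Phi> f p = (\<Sum>n\<le>degree p. (\<Phi> ^^ n) (f (coeff p n)))"

definition mult_var :: "'v::ab_group_add poly \<Rightarrow> 'v poly" where
  "mult_var p = pCons 0 p"

definition mult_lam :: "'v::ab_group_add poly poly \<Rightarrow> 'v poly poly" where
  "mult_lam p = map_poly mult_var p"

definition mult_mu :: "'v::ab_group_add poly poly \<Rightarrow> 'v poly poly" where
  "mult_mu p = mult_var p"

definition at_lam :: "'v::ab_group_add poly \<Rightarrow> 'v poly poly" where
  "at_lam = psubst mult_lam (\<lambda>v. [:[:v:]:])"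

definition at_mu :: "'v::ab_group_add poly \<Rightarrow> 'v poly poly" where
  "at_mu = psubst mult_mu (\<lambda>v. [:[:v:]:])"

definition at_lam_plus_mu :: "'v::ab_group_add poly \<Rightarrow> 'v poly poly" where
  "at_lam_plus_mu = psubst (\<lambda>p. mult_lam p + mult_mu p) (\<lambda>v. [:[:v:]:])"

text \<open>Replace the variable by \<open>-\<partial>-\<lambda>\<close>, with \<open>\<partial>\<close> acting on coefficients.\<close>

definition at_minus_der_lam :: "('v \<Rightarrow> 'v) \<Rightarrow> 'v::ab_group_add poly \<Rightarrow> 'v poly" where
  "at_minus_der_lam der = psubst (\<lambda>q. - map_poly der q - mult_var q) (\<lambda>v. [:v:])"

text \<open>\<open>psign \<alpha> \<beta> v\<close> is \<open>(-1)\<^bsup>\<alpha>\<beta>\<^esup> v\<close>.\<close>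

definition psign :: "bit \<Rightarrow> bit \<Rightarrow> 'v::ab_group_add \<Rightarrow> 'v" where
  "psign \<alpha> \<beta> v = (if \<alpha> * \<beta> = 1 then - v else v)"

locale graded_dmodule = vector_space scale
  for scale :: "complex \<Rightarrow> 'v::ab_group_add \<Rightarrow> 'v" +
  fixes der :: "'v \<Rightarrow> 'v"
    and gr :: "bit \<Rightarrow> 'v set"
  assumes der_linear: "Vector_Spaces.linear scale scale der"
    and gr_subspace: "subspace (gr \<theta>)"
    and gr_der: "v \<in> gr \<theta> \<Longrightarrow> der v \<in> gr \<theta>"
    and gr_Int: "gr 0 \<inter> gr 1 = {0}"
    and gr_sum: "\<exists>v0\<in>gr 0. \<exists>v1\<in>gr 1. v = v0 + v1"
    and fin_gen: "\<exists>S. finite S \<and> span {(der ^^ n) s | n s. s \<in> S} = UNIV"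

definition hcomp :: "(bit \<Rightarrow> 'v set) \<Rightarrow> bit \<Rightarrow> 'v::ab_group_add \<Rightarrow> 'v" where
  "hcomp gr \<theta> v = (THE u. u \<in> gr \<theta> \<and> v - u \<in> gr (\<theta> + 1))"

locale lie_conformal_superalgebra = graded_dmodule scale der gr
  for scale :: "complex \<Rightarrow> 'a::ab_group_add \<Rightarrow> 'a"
    and der :: "'a \<Rightarrow> 'a"
    and gr :: "bit \<Rightarrow> 'a set" +
  fixes br :: "'a \<Rightarrow> 'a \<Rightarrow> 'a poly"
  assumes br_linear_left: "Vector_Spaces.linear scale (pscale scale) (\<lambda>a. br a b)"
    and br_linear_right: "Vector_Spaces.linear scale (pscale scale) (br a)"
    and br_graded: "a \<in> gr \<alpha> \<Longrightarrow> b \<in> gr \<beta> \<Longrightarrow> coeff (br a b) n \<in> gr (\<alpha> + \<beta>)"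
    and C1: "br (der a) b = - mult_var (br a b)"
    and C2: "a \<in> gr \<alpha> \<Longrightarrow> b \<in> gr \<beta> \<Longrightarrow>
      br a b = - psign \<alpha> \<beta> (at_minus_der_lam der (br b a))"
    and C3: "a \<in> gr \<alpha> \<Longrightarrow> b \<in> gr \<beta> \<Longrightarrow> c \<in> gr \<gamma> \<Longrightarrow>
      psubst mult_mu (\<lambda>x. at_lam (br a x)) (br b c) =
      psubst mult_lam (\<lambda>x. at_lam_plus_mu (br x c)) (br a b)
      + psign \<alpha> \<beta> (psubst mult_lam (\<lambda>x. at_mu (br b x)) (br a c))"

definition conformal_linear ::
  "(complex \<Rightarrow> 'm \<Rightarrow> 'm) \<Rightarrow> ('m \<Rightarrow> 'm) \<Rightarrow> (bit \<Rightarrow> 'm set) \<Rightarrow>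
   (complex \<Rightarrow> 'n \<Rightarrow> 'n) \<Rightarrow> ('n \<Rightarrow> 'n) \<Rightarrow> (bit \<Rightarrow> 'n set) \<Rightarrow>
   bit \<Rightarrow> ('m::ab_group_add \<Rightarrow> 'n::ab_group_add poly) \<Rightarrow> bool" where
  "conformal_linear sM dM gM sN dN gN \<theta> f \<longleftrightarrow>
     Vector_Spaces.linear sM (pscale sN) f \<and>
     (\<forall>m. f (dM m) = map_poly dN (f m) + mult_var (f m)) \<and>
     (\<forall>\<eta>. \<forall>m\<in>gM \<eta>. \<forall>n. coeff (f m) n \<in> gN (\<eta> + \<theta>))"

definition Chom ::
  "(complex \<Rightarrow> 'm \<Rightarrow> 'm) \<Rightarrow> ('m \<Rightarrow> 'm) \<Rightarrow> (bit \<Rightarrow> 'm set) \<Rightarrow>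
   (complex \<Rightarrow> 'n \<Rightarrow> 'n) \<Rightarrow> ('n \<Rightarrow> 'n) \<Rightarrow> (bit \<Rightarrow> 'n set) \<Rightarrow>
   ('m::ab_group_add \<Rightarrow> 'n::ab_group_add poly) set" where
  "Chom sM dM gM sN dN gN =
     {\<lambda>m. f m + g m | f g. conformal_linear sM dM gM sN dN gN 0 f \<and>
                            conformal_linear sM dM gM sN dN gN 1 g}"

definition Cend ::
  "(complex \<Rightarrow> 'm \<Rightarrow> 'm) \<Rightarrow> ('m \<Rightarrow> 'm) \<Rightarrow> (bit \<Rightarrow> 'm set) \<Rightarrow>
   ('m::ab_group_add \<Rightarrow> 'm poly) set" where
  "Cend sM dM gM = Chom sM dM gM sM dM gM"

locale conformal_module =
  R: lie_conformal_superalgebra sR dR gR br + M: graded_dmodule sM dM gM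
  for sR :: "complex \<Rightarrow> 'a::ab_group_add \<Rightarrow> 'a"
    and dR :: "'a \<Rightarrow> 'a"
    and gR :: "bit \<Rightarrow> 'a set"
    and br :: "'a \<Rightarrow> 'a \<Rightarrow> 'a poly"
    and sM :: "complex \<Rightarrow> 'b::ab_group_add \<Rightarrow> 'b"
    and dM :: "'b \<Rightarrow> 'b"
    and gM :: "bit \<Rightarrow> 'b set" +
  fixes \<rho> :: "'a \<Rightarrow> 'b \<Rightarrow> 'b poly"
  assumes rho_Cend: "\<rho> r \<in> Cend sM dM gM"
    and rho_linear: "Vector_Spaces.linear sR (pscale sM) (\<lambda>r. \<rho> r m)"
    and rho_graded: "r \<in> gR \<alpha> \<Longrightarrow> conformal_linear sM dM gM sM dM gM \<alpha> (\<rho> r)"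
    and rho_der: "\<rho> (dR a) m = - mult_var (\<rho> a m)"
    and rho_br: "a \<in> gR \<alpha> \<Longrightarrow> b \<in> gR \<beta> \<Longrightarrow>
      psubst mult_mu (\<lambda>x. at_lam (\<rho> a x)) (\<rho> b m)
      - psign \<alpha> \<beta> (psubst mult_lam (\<lambda>x. at_mu (\<rho> b x)) (\<rho> a m)) =
      psubst mult_lam (\<lambda>x. at_lam_plus_mu (\<rho> x m)) (br a b)"

definition sd_scale ::
  "(complex \<Rightarrow> 'a \<Rightarrow> 'a) \<Rightarrow> (complex \<Rightarrow> 'b \<Rightarrow> 'b) \<Rightarrow> complex \<Rightarrow> 'a \<times> 'b \<Rightarrow> 'a \<times> 'b" where
  "sd_scale sR sM c = map_prod (sR c) (sM c)"

definition sd_der :: "('a \<Rightarrow> 'a) \<Rightarrow> ('b \<Rightarrow> 'b) \<Rightarrow> 'a \<times> 'b \<Rightarrow> 'a \<times> 'b" where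
  "sd_der dR dM = map_prod dR dM"

definition sd_gr :: "(bit \<Rightarrow> 'a set) \<Rightarrow> (bit \<Rightarrow> 'b set) \<Rightarrow> bit \<Rightarrow> ('a \<times> 'b) set" where
  "sd_gr gR gM \<theta> = gR \<theta> \<times> gM \<theta>"

definition pair_poly :: "'a::ab_group_add poly \<Rightarrow> 'b::ab_group_add poly \<Rightarrow> ('a \<times> 'b) poly" where
  "pair_poly p q = map_poly (\<lambda>x. (x, 0)) p + map_poly (\<lambda>y. (0, y)) q"

text \<open>The defining formula for \<open>r + m\<close> homogeneous of degree \<open>\<alpha>\<close> and \<open>r' + m'\<close> homogeneous of
  degree \<open>\<beta>\<close>, so that \<open>|r'||m| = \<beta>\<alpha>\<close>.\<close>

definition sd_br_hom ::
  "('a \<Rightarrow> 'a \<Rightarrow> 'a::ab_group_add poly) \<Rightarrow> ('b \<Rightarrow> 'b) \<Rightarrow> ('a \<Rightarrow> 'b \<Rightarrow> 'b::ab_group_add poly) \<Rightarrow>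
   bit \<Rightarrow> bit \<Rightarrow> 'a \<times> 'b \<Rightarrow> 'a \<times> 'b \<Rightarrow> ('a \<times> 'b) poly" where
  "sd_br_hom br dM \<rho> \<alpha> \<beta> = (\<lambda>(r, m) (r', m').
     pair_poly (br r r') (\<rho> r m' - psign \<beta> \<alpha> (at_minus_der_lam dM (\<rho> r' m))))"

definition sd_br ::
  "(bit \<Rightarrow> 'a set) \<Rightarrow> ('a \<Rightarrow> 'a \<Rightarrow> 'a::ab_group_add poly) \<Rightarrow>
   ('b \<Rightarrow> 'b) \<Rightarrow> (bit \<Rightarrow> 'b set) \<Rightarrow> ('a \<Rightarrow> 'b \<Rightarrow> 'b::ab_group_add poly) \<Rightarrow>
   'a \<times> 'b \<Rightarrow> 'a \<times> 'b \<Rightarrow> ('a \<times> 'b) poly" where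
  "sd_br gR br dM gM \<rho> x y =
     (\<Sum>\<alpha>\<in>{0, 1}. \<Sum>\<beta>\<in>{0, 1}.
        sd_br_hom br dM \<rho> \<alpha> \<beta> (hcomp (sd_gr gR gM) \<alpha> x) (hcomp (sd_gr gR gM) \<beta> y))"

text \<open>The bilinear extension agrees with the defining formula on homogeneous elements.\<close>

lemma (in graded_dmodule) gr_0_mem: "0 \<in> gr \<theta>"
  using gr_subspace subspace_0 by blast

lemma (in conformal_module) hcomp_sd_gr:
  assumes "x \<in> sd_gr gR gM \<alpha>"
  shows "hcomp (sd_gr gR gM) \<theta> x = (if \<theta> = \<alpha> then x else 0)"
proof -
  have int: "\<And>v. v \<in> sd_gr gR gM \<theta> \<Longrightarrow> v \<in> sd_gr gR gM (\<theta> + 1) \<Longrightarrow> v = 0" for \<theta>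
    using R.gr_Int M.gr_Int by (cases \<theta>) (auto simp: sd_gr_def zero_prod_def)
  have zero: "0 \<in> sd_gr gR gM \<theta>" for \<theta>
    by (simp add: sd_gr_def zero_prod_def R.gr_0_mem M.gr_0_mem)
  have diff: "u - v \<in> sd_gr gR gM \<theta>"
    if "u \<in> sd_gr gR gM \<theta>" "v \<in> sd_gr gR gM \<theta>" for u v \<theta>
    using that R.subspace_diff[OF R.gr_subspace] M.subspace_diff[OF M.gr_subspace]
    by (auto simp: sd_gr_def)
  have uniq: "u = w" if "u \<in> sd_gr gR gM \<theta>" "x - u \<in> sd_gr gR gM (\<theta> + 1)"
    "w \<in> sd_gr gR gM \<theta>" "x - w \<in> sd_gr gR gM (\<theta> + 1)" for u w
  proof -
    have "(x - w) - (x - u) \<in> sd_gr gR gM (\<theta> + 1)" using that diff by blast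
    hence "u - w \<in> sd_gr gR gM (\<theta> + 1)" by simp
    moreover have "u - w \<in> sd_gr gR gM \<theta>" using that diff by blast
    ultimately show ?thesis using int[of "u - w" \<theta>] by simp
  qed
  let ?w = "if \<theta> = \<alpha> then x else 0"
  have w: "?w \<in> sd_gr gR gM \<theta>" "x - ?w \<in> sd_gr gR gM (\<theta> + 1)"
    using assms zero by (cases \<theta>; cases \<alpha>; simp)+
  show ?thesis unfolding hcomp_def
    by (rule the_equality) (use w uniq in blast)+
qed

lemma linear_at_0: "Vector_Spaces.linear s1 s2 f \<Longrightarrow> f 0 = 0"
  unfolding Vector_Spaces.linear_def using module_hom.zero by blast

lemma psubst_0: "f 0 = 0 \<Longrightarrow> psubst \<Phi> f 0 = 0"
  by (simp add: psubst_def)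

lemma (in conformal_module) sd_br_hom_zero:
  "sd_br_hom br dM \<rho> \<alpha> \<beta> 0 y = 0" "sd_br_hom br dM \<rho> \<alpha> \<beta> x 0 = 0"
proof -
  have zeros: "br 0 b = 0" "br a 0 = 0" "\<rho> 0 m = 0" for a b m
    using linear_at_0[OF R.br_linear_left]
      linear_at_0[OF R.br_linear_right]
      linear_at_0[OF rho_linear]
    by blast+
  have rho0: "\<rho> r 0 = 0" for r
  proof -
    obtain f g where "\<rho> r = (\<lambda>m. f m + g m)"
      "Vector_Spaces.linear sM (pscale sM) f" "Vector_Spaces.linear sM (pscale sM) g"
      using rho_Cend[of r] unfolding Cend_def Chom_def conformal_linear_def by blast
    thus ?thesis by (simp add: linear_at_0)
  qed
  show "sd_br_hom br dM \<rho> \<alpha> \<beta> 0 y = 0" "sd_br_hom br dM \<rho> \<alpha> \<beta> x 0 = 0"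
    by (auto simp: sd_br_hom_def zero_prod_def zeros rho0 pair_poly_def psign_def
        at_minus_der_lam_def psubst_0 split: prod.splits)
qed

lemma (in conformal_module) sd_br_homogeneous:
  assumes "x \<in> sd_gr gR gM \<alpha>" "y \<in> sd_gr gR gM \<beta>"
  shows "sd_br gR br dM gM \<rho> x y = sd_br_hom br dM \<rho> \<alpha> \<beta> x y"
  using assms
  by (cases \<alpha>; cases \<beta>) (simp_all add: sd_br_def hcomp_sd_gr sd_br_hom_zero)

end

theory Submission
  imports Defs
begin

text \<open>
  The \<open>R\<close>-component of the Jacobi identity on \<open>R \<oplus> M\<close> is the one of \<open>R\<close>, and its \<open>M\<close>-component is
  a sum of three terms according to which argument lies in \<open>M\<close>. When it is the third one, the
  identity is the representation property
  \<open>\<rho>(a)\<^sub>\<lambda> \<rho>(b)\<^sub>\<mu> - (-1)\<^bsup>|a||b|\<^esup> \<rho>(b)\<^sub>\<mu> \<rho>(a)\<^sub>\<lambda> = \<rho>([a\<^sub>\<lambda> b])\<^bsub>\<lambda>+\<mu>\<^esub>\<close>; in the other two cases it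
  results from the same property by substituting \<open>-\<partial> - \<lambda> - \<mu>\<close> for one of the variables, because
  \<open>\<rho>(a)\<^sub>\<lambda> \<partial> = (\<partial> + \<lambda>) \<rho>(a)\<^sub>\<lambda>\<close> turns \<open>-\<partial> - \<mu>\<close> under \<open>\<rho>(a)\<^sub>\<lambda>\<close> into \<open>-\<partial> - \<lambda> - \<mu>\<close>. Skew-symmetry
  holds because \<open>\<lambda> \<mapsto> -\<partial> - \<lambda>\<close> is an involution. Every substitution is an additive map
  determined by its values on constants and by its commutation with the variables, so all these
  identities reduce to commutation relations between \<open>\<partial>\<close>, \<open>\<lambda>\<close> and \<open>\<mu>\<close>.
\<close>

section \<open>Substitution of operators into polynomials\<close>

lemma additive_map_poly: "additive f \<Longrightarrow> additive (map_poly f)"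
  by (rule additive.intro, rule poly_eqI) (simp add: coeff_map_poly additive.zero additive.add)

lemma additive_mult_var: "additive mult_var"
  by (rule additive.intro) (simp add: mult_var_def)

lemma additive_mult_lam: "additive mult_lam"
  using additive_map_poly[OF additive_mult_var] by (simp add: mult_lam_def[abs_def] eta_contract_eq)

lemma additive_mult_mu: "additive mult_mu"
  by (rule additive.intro) (simp add: mult_mu_def mult_var_def)

lemma additive_const: "additive (\<lambda>v. [:v:])"
  by (rule additive.intro) simp

lemma additive_const2: "additive (\<lambda>v. [:[:v:]:])"
  by (rule additive.intro) simp

lemma additive_comp: "additive f \<Longrightarrow> additive g \<Longrightarrow> additive (\<lambda>x. f (g x))"
  by (simp add: additive_def)

lemma additive_plus: "additive f \<Longrightarrow> additive g \<Longrightarrow> additive (\<lambda>x. f x + g x)"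
  for f :: "'v::ab_group_add \<Rightarrow> 'w::ab_group_add"
  by (simp add: additive_def algebra_simps)

lemma additive_uminus: "additive f \<Longrightarrow> additive (\<lambda>x. - f x)"
  for f :: "'v::ab_group_add \<Rightarrow> 'w::ab_group_add"
  by (simp add: additive_def algebra_simps)

lemma additive_minus: "additive f \<Longrightarrow> additive g \<Longrightarrow> additive (\<lambda>x. f x - g x)"
  for f :: "'v::ab_group_add \<Rightarrow> 'w::ab_group_add"
  by (simp add: additive_def algebra_simps)

lemma additive_id: "additive (\<lambda>x. x)"
  by (simp add: additive_def)

lemma additive_psign: "additive f \<Longrightarrow> additive (\<lambda>x. psign \<alpha> \<beta> (f x))"
  by (simp add: additive_def psign_def)

lemmas additive_intros = additive_map_poly additive_const additive_const2 additive_plus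
  additive_minus additive_uminus additive_id additive_psign
  additive_mult_var additive_mult_lam additive_mult_mu
  additive_comp[OF additive_mult_var] additive_comp[OF additive_mult_lam]
  additive_comp[OF additive_mult_mu] additive_comp[OF additive_map_poly]
  additive_comp[OF additive_const]

text \<open>Additivity makes every coefficient beyond the degree contribute 0, so any upper bound of
  the degree can serve as the range of summation.\<close>

lemma psubst_eq_sum:
  assumes "additive \<Phi>" "additive f" "degree p \<le> N"
  shows "psubst \<Phi> f p = (\<Sum>n\<le>N. (\<Phi> ^^ n) (f (coeff p n)))"
proof -
  have "(\<Phi> ^^ n) 0 = 0" for n
    by (induction n) (simp_all add: additive.zero[OF assms(1)])
  then show ?thesis
    unfolding psubst_def using assms(3)
    by (intro sum.mono_neutral_left) (auto simp: coeff_eq_0 additive.zero[OF assms(2)])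
qed

text \<open>Horner's rule, the recursion on which the later inductions over polynomials
  rest.\<close>

lemma psubst_pCons:
  assumes "additive \<Phi>" "additive f"
  shows "psubst \<Phi> f (pCons c p) = f c + \<Phi> (psubst \<Phi> f p)"
proof -
  \<comment> \<open>The bound \<open>Suc (degree p)\<close> also covers \<open>p = 0\<close>, where
    \<open>pCons c p\<close> has degree 0.\<close>
  have "psubst \<Phi> f (pCons c p) = (\<Sum>n\<le>Suc (degree p). (\<Phi> ^^ n) (f (coeff (pCons c p) n)))"
    by (rule psubst_eq_sum) (use assms degree_pCons_le in auto)
  also have "\<dots> = f c + (\<Sum>n\<le>degree p. \<Phi> ((\<Phi> ^^ n) (f (coeff p n))))"
    by (subst sum.atMost_Suc_shift) simp
  also have "(\<Sum>n\<le>degree p. \<Phi> ((\<Phi> ^^ n) (f (coeff p n)))) = \<Phi> (psubst \<Phi> f p)"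
    by (simp add: psubst_def additive.sum[OF assms(1)])
  finally show ?thesis .
qed

lemma psubst_mult_var:
  assumes "additive \<Phi>" "additive f"
  shows "psubst \<Phi> f (mult_var p) = \<Phi> (psubst \<Phi> f p)"
  using assms by (simp add: mult_var_def psubst_pCons additive.zero)

lemma additive_psubst:
  assumes "additive \<Phi>" "additive f"
  shows "additive (psubst \<Phi> f)"
proof (rule additive.intro)
  show "psubst \<Phi> f (p + q) = psubst \<Phi> f p + psubst \<Phi> f q" for p q
  proof (induction p q rule: poly_induct2)
    case 0
    then show ?case using assms by (simp add: psubst_0 additive.zero)
  next
    case (pCons a p b q)
    then show ?case
      using assms by (simp add: psubst_pCons additive.add algebra_simps)
  qed
qed

text \<open>By Horner's rule, an additive map that intertwines \<open>\<Phi>\<close> with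
  \<open>\<Psi>\<close> can be pushed through the substitution down to the constants. Most
  computations below are instances, with \<open>g\<close> an evaluation, a projection or another
  substitution.\<close>

lemma psubst_fusion:
  assumes "additive \<Phi>" "additive \<Psi>" "additive f" "additive g" "\<And>w. g (\<Phi> w) = \<Psi> (g w)"
  shows "g (psubst \<Phi> f p) = psubst \<Psi> (\<lambda>v. g (f v)) p"
proof (induction p)
  case 0
  show ?case using assms by (simp add: psubst_0 additive.zero)
next
  case (pCons a p)
  then show ?case using assms by (simp add: psubst_pCons additive_comp additive.add)
qed

lemma psubst_map_poly:
  assumes "additive \<Phi>" "additive f" "additive h"
  shows "psubst \<Phi> f (map_poly h p) = psubst \<Phi> (\<lambda>v. f (h v)) p"
proof (induction p)
  case 0
  show ?case using assms by (simp add: psubst_0 additive.zero)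
next
  case (pCons a p)
  then show ?case
    using assms by (simp add: psubst_pCons additive_comp map_poly_pCons additive.zero)
qed

text \<open>Only the actual coefficients matter. A map can thus be replaced by a formula valid on
  homogeneous elements once the coefficients are known to be homogeneous.\<close>

lemma psubst_cong:
  assumes "\<And>n. f (coeff p n) = g (coeff p n)"
  shows "psubst \<Phi> f p = psubst \<Phi> g p"
  by (simp add: psubst_def assms)

lemma psubst_plus_fun:
  assumes "additive \<Phi>" "additive f" "additive g"
  shows "psubst \<Phi> (\<lambda>x. f x + g x) p = psubst \<Phi> f p + psubst \<Phi> g p"
proof (induction p)
  case 0
  show ?case using assms by (simp add: psubst_0 additive.zero)
next
  case (pCons a p)
  then show ?case
    using assms by (simp add: psubst_pCons additive_plus additive.add)
qed

lemma psubst_uminus_fun: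
  assumes "additive \<Phi>" "additive f"
  shows "psubst \<Phi> (\<lambda>x. - f x) p = - psubst \<Phi> f p"
  by (rule psubst_fusion[symmetric])
    (use assms in \<open>auto simp: additive.minus intro: additive_intros\<close>)

lemma psubst_psign_fun:
  assumes "additive \<Phi>" "additive f"
  shows "psubst \<Phi> (\<lambda>x. psign \<alpha> \<beta> (f x)) p = psign \<alpha> \<beta> (psubst \<Phi> f p)"
  by (cases "\<alpha> * \<beta> = 1")
    (simp_all only: psign_def simp_thms if_True if_False psubst_uminus_fun[OF assms])

lemma psubst_mult_var_const: "psubst mult_var (\<lambda>v. [:v:]) p = p"
proof (induction p)
  case (pCons a p)
  then show ?case
    by (simp add: psubst_pCons[OF additive_mult_var additive_const]) (simp add: mult_var_def)
qed (simp add: psubst_0)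

lemma additive_psign_eq: "additive f \<Longrightarrow> f (psign \<alpha> \<beta> v) = psign \<alpha> \<beta> (f v)"
  by (simp add: psign_def additive.minus)

section \<open>Polynomials in two variables and maps acting on coefficients\<close>

lemma mult_lam_mult_mu: "mult_lam (mult_mu p) = mult_mu (mult_lam p)"
  by (simp add: mult_lam_def mult_mu_def mult_var_def map_poly_pCons)

lemma map_poly_mult_var: "h 0 = 0 \<Longrightarrow> map_poly h (mult_var p) = mult_var (map_poly h p)"
  by (simp add: mult_var_def map_poly_pCons)

lemma map_poly_mult_mu: "h 0 = 0 \<Longrightarrow> map_poly h (mult_mu p) = mult_mu (map_poly h p)"
  by (simp add: mult_mu_def mult_var_def map_poly_pCons)

lemma map_poly_mult_lam:
  "h 0 = 0 \<Longrightarrow> map_poly (map_poly h) (mult_lam p) = mult_lam (map_poly (map_poly h) p)"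
  by (rule poly_eqI) (simp add: mult_lam_def coeff_map_poly map_poly_mult_var mult_var_def[of 0])

lemma additive_at:
  "additive at_lam" "additive at_mu" "additive at_lam_plus_mu"
  unfolding at_lam_def at_mu_def at_lam_plus_mu_def
  by (intro additive_psubst additive_intros)+

text \<open>Maps on coefficients commute with both variables and preserve constants, so fusion
  applies. The maps of interest are \<partial> and the two projections of pairs.\<close>

lemma map_poly_at:
  assumes "additive h"
  shows "map_poly (map_poly h) (at_lam p) = at_lam (map_poly h p)"
    "map_poly (map_poly h) (at_mu p) = at_mu (map_poly h p)"
    "map_poly (map_poly h) (at_lam_plus_mu p) = at_lam_plus_mu (map_poly h p)"
proof -
  note z = additive.zero[OF assms]
  note az = additive.add[OF additive_map_poly[OF additive_map_poly[OF assms]]]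
  have c: "map_poly (map_poly h) [:[:v:]:] = [:[:h v:]:]" for v
    by (simp add: map_poly_pCons z)
  show "map_poly (map_poly h) (at_lam p) = at_lam (map_poly h p)"
    unfolding at_lam_def
    by (subst psubst_fusion[where \<Psi> = mult_lam])
      (auto intro!: additive_intros assms
        simp: map_poly_mult_lam z c psubst_map_poly[OF _ additive_const2 assms]
          additive_mult_lam additive_mult_mu additive_plus)
  show "map_poly (map_poly h) (at_mu p) = at_mu (map_poly h p)"
    unfolding at_mu_def
    by (subst psubst_fusion[where \<Psi> = mult_mu])
      (auto intro!: additive_intros assms
        simp: map_poly_mult_mu z c psubst_map_poly[OF _ additive_const2 assms]
          additive_mult_lam additive_mult_mu additive_plus)
  show "map_poly (map_poly h) (at_lam_plus_mu p) = at_lam_plus_mu (map_poly h p)"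
    unfolding at_lam_plus_mu_def
    by (subst psubst_fusion[where \<Psi> = "\<lambda>p. mult_lam p + mult_mu p"])
      (auto intro!: additive_intros assms
        simp: map_poly_mult_lam map_poly_mult_mu z c az
          psubst_map_poly[OF _ additive_const2 assms] additive_mult_lam additive_mult_mu
          additive_plus)
qed

section \<open>The substitution of -\<partial>-\<lambda> for the variable\<close>

lemma additive_at_minus_der_lam: "additive d \<Longrightarrow> additive (at_minus_der_lam d)"
  unfolding at_minus_der_lam_def by (intro additive_psubst additive_intros)

text \<open>Carrying the polynomial as an argument, this form allows a single chosen occurrence to
  be unfolded when substitutions are nested.\<close>

lemma at_minus_der_lam_eq:
  "at_minus_der_lam d p = psubst (\<lambda>q. - map_poly d q - mult_var q) (\<lambda>v. [:v:]) p"
  by (simp add: at_minus_der_lam_def)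

text \<open>The composition rule: \<open>f\<close> carries \<partial> to \<open>\<Theta>\<close> and
  the variable becomes \<open>\<Psi>\<close>, so -\<partial>-\<lambda> becomes
  -\<open>\<Theta>\<close>-\<open>\<Psi>\<close>. Commutation lets \<open>\<Theta>\<close> leave the
  powers of \<open>\<Psi>\<close>. The shift of \<partial> under \<rho>(a) enters through this
  rule.\<close>

lemma psubst_at_minus_der_lam:
  assumes "additive \<Psi>" "additive \<Theta>" "additive f" "additive d"
    and "\<And>x. f (d x) = \<Theta> (f x)" "\<And>w. \<Theta> (\<Psi> w) = \<Psi> (\<Theta> w)"
  shows "psubst \<Psi> f (at_minus_der_lam d p) = psubst (\<lambda>w. - \<Theta> w - \<Psi> w) f p"
proof -
  have "psubst \<Psi> f (map_poly d q) = \<Theta> (psubst \<Psi> f q)" for q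
  proof -
    have "psubst \<Psi> f (map_poly d q) = psubst \<Psi> (\<lambda>x. \<Theta> (f x)) q"
      using assms by (simp add: psubst_map_poly)
    also have "\<dots> = \<Theta> (psubst \<Psi> f q)"
      using assms by (subst psubst_fusion[where g = \<Theta> and \<Psi> = \<Psi>]) auto
    finally show ?thesis .
  qed
  then have comm: "psubst \<Psi> f (- map_poly d q - mult_var q)
      = - \<Theta> (psubst \<Psi> f q) - \<Psi> (psubst \<Psi> f q)" for q
    using assms additive_psubst[of \<Psi> f]
    by (simp add: additive.diff additive.minus psubst_mult_var)
  have c: "psubst \<Psi> f [:v:] = f v" for v
    using assms by (simp add: psubst_pCons psubst_0 additive.zero)
  show ?thesis
    unfolding at_minus_der_lam_def
    by (subst psubst_fusion[where \<Psi> = "\<lambda>w. - \<Theta> w - \<Psi> w"])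
      (auto intro!: additive_intros additive_psubst assms comm simp: c)
qed

text \<open>The composition rule for \<open>\<Psi>\<close> := -\<partial>-\<lambda> and
  \<open>\<Theta>\<close> := \<partial>, since -\<partial>-(-\<partial>-\<lambda>) =
  \<lambda>.\<close>

lemma at_minus_der_lam_involution:
  assumes "additive d"
  shows "at_minus_der_lam d (at_minus_der_lam d p) = p"
proof -
  have "at_minus_der_lam d (at_minus_der_lam d p)
      = psubst (\<lambda>w. - map_poly d w - (- map_poly d w - mult_var w)) (\<lambda>v. [:v:]) p"
    using assms additive.zero[OF assms] unfolding at_minus_der_lam_eq[of d "at_minus_der_lam d p"]
    by (intro psubst_at_minus_der_lam additive_intros)
      (simp_all add: map_poly_pCons additive.diff additive.minus additive_map_poly map_poly_mult_var)
  then show ?thesis by (simp add: psubst_mult_var_const)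
qed

lemma map_poly_at_minus_der_lam:
  assumes "additive d" "additive e" "additive h" "\<And>x. h (d x) = e (h x)"
  shows "map_poly h (at_minus_der_lam d p) = at_minus_der_lam e (map_poly h p)"
proof -
  let ?\<Phi> = "\<lambda>q. - map_poly d q - mult_var q" and ?\<Psi> = "\<lambda>q. - map_poly e q - mult_var q"
  have a: "additive ?\<Phi>" "additive ?\<Psi>" by (intro additive_intros assms)+
  have "map_poly h (map_poly d q) = map_poly e (map_poly h q)" for q
    by (rule poly_eqI) (simp add: coeff_map_poly assms additive.zero)
  then have "map_poly h (?\<Phi> q) = ?\<Psi> (map_poly h q)" for q
    using assms
    by (simp add: additive.diff[OF additive_map_poly] additive.minus[OF additive_map_poly]
        map_poly_mult_var additive.zero)
  then have "map_poly h (at_minus_der_lam d p) = psubst ?\<Psi> (\<lambda>v. map_poly h [:v:]) p"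
    unfolding at_minus_der_lam_eq
    by (intro psubst_fusion a additive_const additive_map_poly assms)
  also have "\<dots> = at_minus_der_lam e (map_poly h p)"
    using assms
    by (simp add: at_minus_der_lam_eq psubst_map_poly a additive_const map_poly_pCons additive.zero)
  finally show ?thesis .
qed

text \<open>Under the substitution \<partial>+\<lambda> becomes \<partial>+(-\<partial>-\<lambda>) =
  -\<lambda>. This turns the rule for \<partial> in the argument of \<rho>(r) into what (C1) demands
  of the third term of the bracket.\<close>

lemma at_minus_der_lam_sesqui:
  assumes "additive d"
  shows "at_minus_der_lam d (map_poly d p + mult_var p) = - mult_var (at_minus_der_lam d p)"
proof -
  have "additive (\<lambda>q. - map_poly d q - mult_var q)" by (intro additive_intros assms)
  then have "at_minus_der_lam d (mult_var p)
      = - map_poly d (at_minus_der_lam d p) - mult_var (at_minus_der_lam d p)"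
    by (simp only: at_minus_der_lam_eq psubst_mult_var additive_const)
  then show ?thesis
    using map_poly_at_minus_der_lam[OF assms assms assms refl, of p]
    by (simp add: additive.add[OF additive_at_minus_der_lam[OF assms]])
qed

text \<open>Horner's rule builds the result from the coefficients of \<open>p\<close> by \<partial>,
  shifts, sums and differences, all of which stay in \<open>S\<close>. The intended \<open>S\<close>
  is a homogeneous component.\<close>

lemma coeff_at_minus_der_lam_mem:
  assumes "additive d" and S: "0 \<in> S" "\<And>x y. x \<in> S \<Longrightarrow> y \<in> S \<Longrightarrow> x - y \<in> S"
    and d: "\<And>x. x \<in> S \<Longrightarrow> d x \<in> S" and "\<And>n. coeff p n \<in> S"
  shows "coeff (at_minus_der_lam d p) n \<in> S"
  using assms(5)
proof (induction p arbitrary: n)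
  case 0
  show ?case using S by (simp add: at_minus_der_lam_def psubst_0)
next
  case (pCons a p)
  have neg: "- x \<in> S" if "x \<in> S" for x using S(2)[OF S(1) that] by simp
  have add: "x + y \<in> S" if "x \<in> S" "y \<in> S" for x y using S(2)[OF that(1) neg[OF that(2)]] by simp
  have a: "a \<in> S" using pCons.prems[of 0] by simp
  have "coeff p n \<in> S" for n using pCons.prems[of "Suc n"] by simp
  then have IH: "coeff (at_minus_der_lam d p) n \<in> S" for n by (rule pCons.IH)
  have "at_minus_der_lam d (pCons a p)
      = [:a:] + (- map_poly d (at_minus_der_lam d p) - mult_var (at_minus_der_lam d p))"
    unfolding at_minus_der_lam_def by (intro psubst_pCons additive_intros assms)
  moreover have "coeff [:a:] n \<in> S" "coeff (mult_var (at_minus_der_lam d p)) n \<in> S"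
    using a IH S by (simp_all add: coeff_pCons mult_var_def split: nat.split)
  moreover have "coeff (map_poly d (at_minus_der_lam d p)) n \<in> S"
    using IH d by (simp add: coeff_map_poly additive.zero[OF assms(1)])
  ultimately show ?case by (auto intro!: add S neg simp del: coeff_pCons)
qed

section \<open>Pairs of polynomials\<close>

lemma additive_proj: "additive fst" "additive snd"
  "additive (\<lambda>x. (x, 0::'b::ab_group_add))" "additive (Pair (0::'c::ab_group_add))"
  by (auto simp: additive_def)

lemma coeff_pair_poly: "coeff (pair_poly p q) n = (coeff p n, coeff q n)"
  by (simp add: pair_poly_def coeff_map_poly zero_prod_def)

lemma map_poly_pair_poly:
  "map_poly fst (pair_poly p q) = p" "map_poly snd (pair_poly p q) = q"
  by (auto intro!: poly_eqI simp: coeff_map_poly coeff_pair_poly)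

lemma poly_prod_eqI:
  assumes "map_poly fst p = map_poly fst q" "map_poly snd p = map_poly snd q"
  shows "p = q"
proof (rule poly_eqI, rule prod_eqI)
  fix n
  show "fst (coeff p n) = fst (coeff q n)" "snd (coeff p n) = snd (coeff q n)"
    using arg_cong[OF assms(1), of "\<lambda>r. coeff r n"] arg_cong[OF assms(2), of "\<lambda>r. coeff r n"]
    by (simp_all add: coeff_map_poly)
qed

lemma poly_poly_prod_eqI:
  assumes "map_poly (map_poly fst) p = map_poly (map_poly fst) q"
    "map_poly (map_poly snd) p = map_poly (map_poly snd) q"
  shows "p = q"
proof (rule poly_eqI, rule poly_prod_eqI)
  fix n
  show "map_poly fst (coeff p n) = map_poly fst (coeff q n)"
    "map_poly snd (coeff p n) = map_poly snd (coeff q n)"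
    using arg_cong[OF assms(1), of "\<lambda>r. coeff r n"] arg_cong[OF assms(2), of "\<lambda>r. coeff r n"]
    by (simp_all add: coeff_map_poly)
qed

lemma additive_pair_poly:
  "additive f \<Longrightarrow> additive g \<Longrightarrow> additive (\<lambda>x. pair_poly (f x) (g x))"
  by (auto simp: additive_def intro!: poly_eqI simp: coeff_pair_poly)

lemma map_poly_proj_mult_lam:
  "map_poly (map_poly fst) (mult_lam w) = mult_lam (map_poly (map_poly fst) w)"
  "map_poly (map_poly snd) (mult_lam w) = mult_lam (map_poly (map_poly snd) w)"
  by (simp_all add: map_poly_mult_lam)

lemma map_poly_proj_mult_mu:
  "map_poly (map_poly fst) (mult_mu w) = mult_mu (map_poly (map_poly fst) w)"
  "map_poly (map_poly snd) (mult_mu w) = mult_mu (map_poly (map_poly snd) w)"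
  by (simp_all add: map_poly_mult_mu)

text \<open>Projecting to a component is a fusion. \<open>F\<close> will be a bracket with one
  argument fixed, \<open>\<Xi>\<close> one of the embeddings \<open>at_lam\<close>,
  \<open>at_mu\<close>, \<open>at_lam_plus_mu\<close>, and \<open>g\<close>, \<open>h\<close> the
  contributions of the two parts of the varying argument to the chosen component.\<close>

lemma psubst_at_pair_poly:
  assumes "additive \<Phi>" "additive \<Psi>" "additive g" "additive h"
    and "additive \<Xi>" "additive \<Xi>'" "additive pr"
    and "\<And>w. map_poly (map_poly pr) (\<Phi> w) = \<Psi> (map_poly (map_poly pr) w)"
    and "\<And>p. map_poly (map_poly pr) (\<Xi> p) = \<Xi>' (map_poly pr p)"
    and "\<And>x y. map_poly pr (F (x, y)) = g x + h y"
    and "additive F"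
  shows "map_poly (map_poly pr) (psubst \<Phi> (\<lambda>x. \<Xi> (F x)) (pair_poly p q))
    = psubst \<Psi> (\<lambda>x. \<Xi>' (g x)) p + psubst \<Psi> (\<lambda>x. \<Xi>' (h x)) q"
proof -
  have g: "additive (\<lambda>x. \<Xi>' (g x))" and h: "additive (\<lambda>x. \<Xi>' (h x))"
    by (intro additive_comp[OF assms(6)] assms)+
  have F: "additive (\<lambda>x. \<Xi> (F x))"
    by (intro additive_comp[of \<Xi> F] assms)
  have "map_poly (map_poly pr) (\<Xi> (F x)) = \<Xi>' (g (fst x)) + \<Xi>' (h (snd x))" for x
    by (cases x) (simp only: assms(9,10) additive.add[OF assms(6)] fst_conv snd_conv)
  then have "map_poly (map_poly pr) (psubst \<Phi> (\<lambda>x. \<Xi> (F x)) (pair_poly p q))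
      = psubst \<Psi> (\<lambda>x. \<Xi>' (g (fst x)) + \<Xi>' (h (snd x))) (pair_poly p q)"
    using psubst_fusion[OF assms(1,2) F additive_map_poly[OF additive_map_poly[OF assms(7)]] assms(8),
        where p = "pair_poly p q"]
    by simp
  also have "\<dots> = psubst \<Psi> (\<lambda>x. \<Xi>' (g (fst x))) (pair_poly p q)
      + psubst \<Psi> (\<lambda>x. \<Xi>' (h (snd x))) (pair_poly p q)"
    by (intro psubst_plus_fun additive_comp[OF g] additive_comp[OF h] additive_proj assms)
  \<comment> \<open>This summand factors through \<open>map_poly fst\<close>, which recovers
    \<open>p\<close>; the other one factors through \<open>map_poly snd\<close>.\<close>
  also have "psubst \<Psi> (\<lambda>x. \<Xi>' (g (fst x))) (pair_poly p q) = psubst \<Psi> (\<lambda>x. \<Xi>' (g x)) p"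
    using psubst_map_poly[OF assms(2) g additive_proj(1), of "pair_poly p q"]
    by (simp add: map_poly_pair_poly)
  also have "psubst \<Psi> (\<lambda>x. \<Xi>' (h (snd x))) (pair_poly p q) = psubst \<Psi> (\<lambda>x. \<Xi>' (h x)) q"
    using psubst_map_poly[OF assms(2) h additive_proj(2), of "pair_poly p q"]
    by (simp add: map_poly_pair_poly)
  finally show ?thesis .
qed

section \<open>Substituting operators for both variables\<close>

text \<open>Evaluation at \<lambda> := \<open>\<Phi>\<close> and \<mu> := \<open>\<Psi>\<close>:
  \<lambda> is the inner variable, so \<open>\<Phi>\<close> acts inside the coefficients. It serves
  to replace a variable by -\<partial>-\<lambda>-\<mu> in an identity between polynomials in two
  variables.\<close>

definition subst2 ::
  "('w \<Rightarrow> 'w) \<Rightarrow> ('w \<Rightarrow> 'w) \<Rightarrow> ('v \<Rightarrow> 'w) \<Rightarrow> 'v::ab_group_add poly poly \<Rightarrow> 'w::ab_group_add" where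
  "subst2 \<Phi> \<Psi> f = psubst \<Psi> (psubst \<Phi> f)"

lemma
  assumes "additive \<Phi>" "additive \<Psi>" "additive f"
  shows additive_subst2: "additive (subst2 \<Phi> \<Psi> f)"
    and subst2_const: "subst2 \<Phi> \<Psi> f [:[:v:]:] = f v"
    and subst2_mult_mu: "subst2 \<Phi> \<Psi> f (mult_mu w) = \<Psi> (subst2 \<Phi> \<Psi> f w)"
proof -
  have a: "additive (psubst \<Phi> f)" by (intro additive_psubst assms)
  show "additive (subst2 \<Phi> \<Psi> f)" unfolding subst2_def by (intro additive_psubst a assms)
  show "subst2 \<Phi> \<Psi> f [:[:v:]:] = f v"
    using assms by (simp add: subst2_def psubst_pCons a psubst_0 additive.zero)
  show "subst2 \<Phi> \<Psi> f (mult_mu w) = \<Psi> (subst2 \<Phi> \<Psi> f w)"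
    by (simp add: subst2_def mult_mu_def psubst_mult_var a assms)
qed

text \<open>\<open>\<Phi>\<close> arises inside each coefficient, below the powers of
  \<open>\<Psi>\<close>, and has to be moved out across them; hence the commutation
  hypothesis.\<close>

lemma subst2_mult_lam:
  assumes "additive \<Phi>" "additive \<Psi>" "additive f" "\<And>w. \<Phi> (\<Psi> w) = \<Psi> (\<Phi> w)"
  shows "subst2 \<Phi> \<Psi> f (mult_lam w) = \<Phi> (subst2 \<Phi> \<Psi> f w)"
proof -
  have a: "additive (psubst \<Phi> f)" by (intro additive_psubst assms)
  have "subst2 \<Phi> \<Psi> f (mult_lam w) = psubst \<Psi> (\<lambda>v. \<Phi> (psubst \<Phi> f v)) w"
    by (simp add: subst2_def mult_lam_def psubst_map_poly psubst_mult_var a assms additive_mult_var)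
  also have "\<dots> = \<Phi> (subst2 \<Phi> \<Psi> f w)"
    unfolding subst2_def by (rule psubst_fusion[symmetric]) (use assms a in auto)
  finally show ?thesis .
qed

lemma
  assumes "additive \<Phi>" "additive \<Psi>" "additive f" "\<And>w. \<Phi> (\<Psi> w) = \<Psi> (\<Phi> w)"
  shows subst2_at_lam: "subst2 \<Phi> \<Psi> f (at_lam p) = psubst \<Phi> f p"
    and subst2_at_mu: "subst2 \<Phi> \<Psi> f (at_mu p) = psubst \<Psi> f p"
    and subst2_at_lam_plus_mu:
      "subst2 \<Phi> \<Psi> f (at_lam_plus_mu p) = psubst (\<lambda>w. \<Phi> w + \<Psi> w) f p"
proof -
  note s = additive_subst2[OF assms(1-3)] subst2_const[OF assms(1-3)]
    subst2_mult_mu[OF assms(1-3)] subst2_mult_lam[OF assms]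
  show "subst2 \<Phi> \<Psi> f (at_lam p) = psubst \<Phi> f p"
    unfolding at_lam_def by (subst psubst_fusion[where \<Psi> = \<Phi>])
      (auto intro!: additive_intros assms s simp: s)
  show "subst2 \<Phi> \<Psi> f (at_mu p) = psubst \<Psi> f p"
    unfolding at_mu_def by (subst psubst_fusion[where \<Psi> = \<Psi>])
      (auto intro!: additive_intros assms s simp: s)
  show "subst2 \<Phi> \<Psi> f (at_lam_plus_mu p) = psubst (\<lambda>w. \<Phi> w + \<Psi> w) f p"
    unfolding at_lam_plus_mu_def by (subst psubst_fusion[where \<Psi> = "\<lambda>w. \<Phi> w + \<Psi> w"])
      (auto intro!: additive_intros assms s simp: s additive.add[OF s(1)])
qed

section \<open>Graded modules\<close>

lemma linear_additive: "Vector_Spaces.linear s1 s2 f \<Longrightarrow> additive f"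
  by (simp add: Vector_Spaces.linear_iff additive_def)

lemma coeff_pscale:
  assumes "vector_space s"
  shows "coeff (pscale s c p) n = s c (coeff p n)"
proof -
  interpret vector_space s by (rule assms)
  show ?thesis by (simp add: pscale_def coeff_map_poly)
qed

lemma vector_space_pscale:
  assumes "vector_space s"
  shows "vector_space (pscale s)"
proof -
  interpret vector_space s by (rule assms)
  show ?thesis
    by unfold_locales
      (rule poly_eqI, simp add: coeff_pscale[OF assms] scale_right_distrib scale_left_distrib)+
qed

lemma vector_space_sd_scale:
  assumes "vector_space s" "vector_space t"
  shows "vector_space (sd_scale s t)"
proof -
  interpret s: vector_space s by (rule assms)
  interpret t: vector_space t by (rule assms)
  show ?thesis
    by unfold_locales
      (auto simp: sd_scale_def s.scale_right_distrib s.scale_left_distrib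
        t.scale_right_distrib t.scale_left_distrib)
qed

context graded_dmodule
begin

lemma additive_der: "additive der"
  using linear_additive[OF der_linear] .

lemma der_scale: "der (scale c v) = scale c (der v)"
  using der_linear by (simp add: Vector_Spaces.linear_iff)

text \<open>This makes the definite description in \<open>hcomp\<close> usable: two candidates
  differ by an element of both homogeneous parts, which is 0.\<close>

lemma hcomp_eq:
  assumes "u \<in> gr \<theta>" "v - u \<in> gr (\<theta> + 1)"
  shows "hcomp gr \<theta> v = u"
  unfolding hcomp_def
proof (rule the_equality)
  fix w assume w: "w \<in> gr \<theta> \<and> v - w \<in> gr (\<theta> + 1)"
  then have "u - w \<in> gr \<theta>"
    using assms by (blast intro: subspace_diff[OF gr_subspace])
  moreover have "(v - w) - (v - u) \<in> gr (\<theta> + 1)"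
    using w assms by (blast intro: subspace_diff[OF gr_subspace])
  moreover have "(v - w) - (v - u) = u - w" by simp
  ultimately have "u - w \<in> gr 0 \<inter> gr 1"
    by (cases \<theta>) simp_all
  then show "w = u" using gr_Int by simp
qed (use assms in simp)

lemma hcomp_mem: "hcomp gr \<theta> v \<in> gr \<theta>" "v - hcomp gr \<theta> v \<in> gr (\<theta> + 1)"
proof -
  obtain v0 v1 where v: "v0 \<in> gr 0" "v1 \<in> gr 1" "v = v0 + v1" using gr_sum by blast
  have "\<exists>u. u \<in> gr \<theta> \<and> v - u \<in> gr (\<theta> + 1)"
    using v by (cases \<theta>) (auto intro: exI[of _ v0] exI[of _ v1])
  then show "hcomp gr \<theta> v \<in> gr \<theta>" "v - hcomp gr \<theta> v \<in> gr (\<theta> + 1)"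
    using hcomp_eq by auto
qed

lemma hcomp_add: "hcomp gr \<theta> (v + w) = hcomp gr \<theta> v + hcomp gr \<theta> w"
proof (rule hcomp_eq)
  show "hcomp gr \<theta> v + hcomp gr \<theta> w \<in> gr \<theta>"
    by (intro subspace_add gr_subspace hcomp_mem)
  have "(v - hcomp gr \<theta> v) + (w - hcomp gr \<theta> w) \<in> gr (\<theta> + 1)"
    by (intro subspace_add gr_subspace hcomp_mem)
  then show "v + w - (hcomp gr \<theta> v + hcomp gr \<theta> w) \<in> gr (\<theta> + 1)"
    by (simp add: algebra_simps)
qed

lemma hcomp_scale: "hcomp gr \<theta> (scale c v) = scale c (hcomp gr \<theta> v)"
proof (rule hcomp_eq)
  show "scale c (hcomp gr \<theta> v) \<in> gr \<theta>"
    by (intro subspace_scale gr_subspace hcomp_mem)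
  show "scale c v - scale c (hcomp gr \<theta> v) \<in> gr (\<theta> + 1)"
    unfolding scale_right_diff_distrib[symmetric] by (intro subspace_scale gr_subspace hcomp_mem)
qed

lemma hcomp_der: "hcomp gr \<theta> (der v) = der (hcomp gr \<theta> v)"
proof (rule hcomp_eq)
  show "der (hcomp gr \<theta> v) \<in> gr \<theta>"
    by (intro gr_der hcomp_mem)
  show "der v - der (hcomp gr \<theta> v) \<in> gr (\<theta> + 1)"
    unfolding additive.diff[OF additive_der, symmetric] by (intro gr_der hcomp_mem)
qed

lemma at_minus_der_lam_pscale:
  "at_minus_der_lam der (pscale scale c p) = pscale scale c (at_minus_der_lam der p)"
proof -
  have "additive (scale c)" by (simp add: additive_def scale_right_distrib)
  from map_poly_at_minus_der_lam[OF additive_der additive_der this]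
  show ?thesis by (simp add: pscale_def der_scale)
qed

lemma coeff_at_minus_der_lam_gr:
  "(\<And>n. coeff p n \<in> gr \<theta>) \<Longrightarrow> coeff (at_minus_der_lam der p) n \<in> gr \<theta>"
  by (rule coeff_at_minus_der_lam_mem)
    (auto intro: additive_der subspace_diff gr_subspace gr_der gr_0_mem)

end

lemma graded_dmodule_sd:
  assumes "graded_dmodule s d g" "graded_dmodule t e h"
  shows "graded_dmodule (sd_scale s t) (sd_der d e) (sd_gr g h)"
proof -
  interpret s: graded_dmodule s d g by (rule assms)
  interpret t: graded_dmodule t e h by (rule assms)
  interpret st: vector_space "sd_scale s t"
    by (intro vector_space_sd_scale s.vector_space_axioms t.vector_space_axioms)
  show ?thesis
  proof (intro graded_dmodule.intro graded_dmodule_axioms.intro st.vector_space_axioms)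
    show "Vector_Spaces.linear (sd_scale s t) (sd_scale s t) (sd_der d e)"
      by (auto simp: Vector_Spaces.linear_iff st.vector_space_axioms sd_der_def sd_scale_def
          s.der_scale t.der_scale additive.add[OF s.additive_der] additive.add[OF t.additive_der])
    show "st.subspace (sd_gr g h \<theta>)" for \<theta>
      using s.gr_subspace[of \<theta>] t.gr_subspace[of \<theta>]
      by (auto simp: st.subspace_def s.subspace_def t.subspace_def sd_gr_def sd_scale_def
          zero_prod_def)
    show "sd_der d e v \<in> sd_gr g h \<theta>" if "v \<in> sd_gr g h \<theta>" for v \<theta>
      using that by (auto simp: sd_gr_def sd_der_def s.gr_der t.gr_der)
    show "sd_gr g h 0 \<inter> sd_gr g h 1 = {0}"
      using s.gr_Int t.gr_Int by (auto simp: sd_gr_def zero_prod_def)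
    show "\<exists>v0\<in>sd_gr g h 0. \<exists>v1\<in>sd_gr g h 1. v = v0 + v1" for v
    proof -
      obtain x0 x1 where "x0 \<in> g 0" "x1 \<in> g 1" "fst v = x0 + x1"
        using s.gr_sum by blast
      moreover obtain y0 y1 where "y0 \<in> h 0" "y1 \<in> h 1" "snd v = y0 + y1"
        using t.gr_sum by blast
      ultimately show ?thesis
        by (intro bexI[of _ "(x0, y0)"] bexI[of _ "(x1, y1)"]) (auto simp: sd_gr_def prod_eq_iff)
    qed
    obtain S T where S: "finite S" "s.span {(d ^^ n) x |n x. x \<in> S} = UNIV"
      and T: "finite T" "t.span {(e ^^ n) x |n x. x \<in> T} = UNIV"
      using s.fin_gen t.fin_gen by blast
    \<comment> \<open>Generators of the two summands, padded with 0, generate the direct sum over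
      \<complex>[\<partial>].\<close>
    let ?W = "(\<lambda>x. (x, 0)) ` S \<union> Pair 0 ` T"
    let ?V = "st.span {(sd_der d e ^^ n) w |n w. w \<in> ?W}"
    have "(d ^^ n) 0 = 0" "(e ^^ n) 0 = 0" for n
      by (induction n)
        (simp_all add: additive.zero[OF s.additive_der] additive.zero[OF t.additive_der])
    moreover have "(sd_der d e ^^ n) (x, y) = ((d ^^ n) x, (e ^^ n) y)" for n x y
      by (induction n) (simp_all add: sd_der_def)
    ultimately have gen: "(sd_der d e ^^ n) (x, 0) = ((d ^^ n) x, 0)"
      "(sd_der d e ^^ n) (0, y) = (0, (e ^^ n) y)" for n x y
      by simp_all
    have st: "st.subspace ?V" by (rule st.subspace_span)
    \<comment> \<open>The slice of \<open>?V\<close> along the first axis is a subspace containing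
      every \<open>(d ^^ n) x\<close> with \<open>x \<in> S\<close>, hence everything. The second
      axis is treated alike, and sums give all pairs.\<close>
    have "s.subspace {x. (x, 0) \<in> ?V}"
      unfolding s.subspace_def
      using st.subspace_0[OF st] st.subspace_add[OF st, of "(_, 0)" "(_, 0)"]
        st.subspace_scale[OF st, of "(_, 0)"]
      by (auto simp: zero_prod_def sd_scale_def)
    moreover have "((d ^^ n) x, 0) \<in> ?V" if "x \<in> S" for x n
      using that unfolding gen(1)[symmetric] by (intro st.span_base) blast
    ultimately have V1: "(x, 0) \<in> ?V" for x
      using s.span_minimal[of "{(d ^^ n) x |n x. x \<in> S}" "{x. (x, 0) \<in> ?V}"] S(2) by blast
    have "t.subspace {y. (0, y) \<in> ?V}"
      unfolding t.subspace_def
      using st.subspace_0[OF st] st.subspace_add[OF st, of "(0, _)" "(0, _)"]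
        st.subspace_scale[OF st, of "(0, _)"]
      by (auto simp: zero_prod_def sd_scale_def)
    moreover have "(0, (e ^^ n) y) \<in> ?V" if "y \<in> T" for y n
      using that unfolding gen(2)[symmetric] by (intro st.span_base) blast
    ultimately have V2: "(0, y) \<in> ?V" for y
      using t.span_minimal[of "{(e ^^ n) x |n x. x \<in> T}" "{y. (0, y) \<in> ?V}"] T(2) by blast
    have "(x, y) \<in> ?V" for x y
      using st.subspace_add[OF st V1 V2, of x y] by simp
    then have "?V = UNIV" by auto
    moreover have "finite ?W" using S(1) T(1) by simp
    ultimately show "\<exists>W. finite W \<and> st.span {(sd_der d e ^^ n) w |n w. w \<in> W} = UNIV"
      by (intro exI[of _ ?W] conjI)
  qed
qed

section \<open>The semidirect product\<close>

context conformal_module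
begin

lemma additive_br: "additive (\<lambda>a. br a b)" "additive (br a)"
  by (rule linear_additive R.br_linear_left R.br_linear_right)+

text \<open>As \<open>r\<close> need not be homogeneous, both properties are taken from the even and
  odd parts of \<open>\<rho> r\<close> given by \<open>Cend\<close> and then added.\<close>

lemma rho_linear_right: "Vector_Spaces.linear sM (pscale sM) (\<rho> r)"
  and rho_der_right: "\<rho> r (dM m) = map_poly dM (\<rho> r m) + mult_var (\<rho> r m)"
proof -
  obtain f g where fg: "\<rho> r = (\<lambda>m. f m + g m)"
    "conformal_linear sM dM gM sM dM gM 0 f" "conformal_linear sM dM gM sM dM gM 1 g"
    using rho_Cend[of r] unfolding Cend_def Chom_def by blast
  then have lin: "Vector_Spaces.linear sM (pscale sM) f" "Vector_Spaces.linear sM (pscale sM) g"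
    by (simp_all add: conformal_linear_def)
  interpret P: vector_space "pscale sM" by (rule vector_space_pscale[OF M.vector_space_axioms])
  show "Vector_Spaces.linear sM (pscale sM) (\<rho> r)"
    using lin by (auto simp: Vector_Spaces.linear_iff fg(1) P.scale_right_distrib algebra_simps)
  show "\<rho> r (dM m) = map_poly dM (\<rho> r m) + mult_var (\<rho> r m)"
    using fg by (simp add: conformal_linear_def additive.add[OF additive_map_poly[OF M.additive_der]]
        additive.add[OF additive_mult_var] algebra_simps)
qed

lemma additive_rho: "additive (\<lambda>r. \<rho> r m)" "additive (\<rho> r)"
  by (rule linear_additive rho_linear rho_linear_right)+

section \<open>The representation identity after substituting -\<partial>-\<lambda>-\<mu>\<close>

abbreviation ader :: "'b poly \<Rightarrow> 'b poly" where
  "ader \<equiv> at_minus_der_lam dM"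

abbreviation der2 :: "'b poly poly \<Rightarrow> 'b poly poly" where
  "der2 \<equiv> map_poly (map_poly dM)"

abbreviation const2 :: "'b \<Rightarrow> 'b poly poly" where
  "const2 \<equiv> \<lambda>v. [:[:v:]:]"

abbreviation neg_all :: "'b poly poly \<Rightarrow> 'b poly poly" where
  "neg_all \<equiv> \<lambda>w. - der2 w - mult_lam w - mult_mu w"

lemma additive_der2: "additive der2"
  by (intro additive_map_poly M.additive_der)

lemma additive_ader: "additive ader"
  by (intro additive_at_minus_der_lam M.additive_der)

lemma additive_neg_all: "additive neg_all"
  by (intro additive_intros additive_der2)

lemmas operator_simps =
  additive.add[OF additive_der2] additive.diff[OF additive_der2] additive.minus[OF additive_der2]
  additive.add[OF additive_mult_lam] additive.diff[OF additive_mult_lam]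
  additive.minus[OF additive_mult_lam]
  additive.add[OF additive_mult_mu] additive.diff[OF additive_mult_mu]
  additive.minus[OF additive_mult_mu]
  map_poly_mult_lam[of dM, OF additive.zero[OF M.additive_der]]
  map_poly_mult_mu[of "map_poly dM", OF additive.zero[OF additive_map_poly[OF M.additive_der]]]
  mult_lam_mult_mu

lemmas operator_additive = additive_intros additive_der2 additive_at M.additive_der
  additive_rho additive_ader additive_psubst additive_neg_all

lemma der2_const2: "der2 (const2 v) = const2 (dM v)"
  by (simp add: map_poly_pCons additive.zero[OF M.additive_der])

text \<open>The composition rule with \<partial> acting on coefficients as \<open>\<Theta>\<close>.
  The last equation recognizes an evaluation at \<open>neg_all\<close> as
  \<open>at_lam_plus_mu\<close> of an \<open>ader\<close>.\<close>

lemma at_ader: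
  "at_lam (ader p) = psubst (\<lambda>w. - der2 w - mult_lam w) const2 p"
  "at_mu (ader p) = psubst (\<lambda>w. - der2 w - mult_mu w) const2 p"
  "at_lam_plus_mu (ader p) = psubst neg_all const2 p"
proof -
  have *: "psubst \<Psi> const2 (ader p) = psubst (\<lambda>w. - der2 w - \<Psi> w) const2 p"
    if "additive \<Psi>" "\<And>w. der2 (\<Psi> w) = \<Psi> (der2 w)" for \<Psi>
    using that der2_const2 by (intro psubst_at_minus_der_lam operator_additive) simp_all
  show "at_lam (ader p) = psubst (\<lambda>w. - der2 w - mult_lam w) const2 p"
    unfolding at_lam_def by (rule *) (auto intro: operator_additive simp: operator_simps)
  show "at_mu (ader p) = psubst (\<lambda>w. - der2 w - mult_mu w) const2 p"
    unfolding at_mu_def by (rule *) (auto intro: operator_additive simp: operator_simps)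
  have "(\<lambda>w. - der2 w - (mult_lam w + mult_mu w)) = neg_all"
    by (simp add: fun_eq_iff algebra_simps)
  then show "at_lam_plus_mu (ader p) = psubst neg_all const2 p"
    unfolding at_lam_plus_mu_def
    by (subst *) (auto intro!: operator_additive simp: operator_simps)
qed

text \<open>Supplies \<open>\<Theta>\<close> = \<partial>+\<lambda> and \<open>\<Theta>\<close> =
  \<partial>+\<mu> for the composition rule.\<close>

lemma at_rho_der:
  "at_lam (\<rho> a (dM x)) = der2 (at_lam (\<rho> a x)) + mult_lam (at_lam (\<rho> a x))"
  "at_mu (\<rho> a (dM x)) = der2 (at_mu (\<rho> a x)) + mult_mu (at_mu (\<rho> a x))"
  by (simp_all add: rho_der_right additive.add[OF additive_at(1)] additive.add[OF additive_at(2)]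
      map_poly_at[OF M.additive_der, symmetric])
    (simp_all add: at_lam_def at_mu_def psubst_mult_var operator_additive)

text \<open>The representation identity at \<open>\<mu> := -\<partial> - \<lambda> - \<mu>\<close>.\<close>

lemma rho_br_middle:
  assumes "a \<in> gR \<alpha>" "c \<in> gR \<gamma>"
  shows "psubst mult_mu (\<lambda>x. at_lam (\<rho> a x)) (ader (\<rho> c m))
      - psign \<alpha> \<gamma> (psubst mult_lam (\<lambda>x. at_lam_plus_mu (ader (\<rho> c x))) (\<rho> a m))
    = psubst mult_lam (\<lambda>x. at_mu (ader (\<rho> x m))) (br a c)"
proof -
  \<comment> \<open>\<open>?E\<close> keeps \<lambda> and replaces \<mu> by
    -\<partial>-\<lambda>-\<mu>.\<close>
  let ?E = "subst2 mult_lam neg_all const2"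
  have E: "additive ?E" by (intro additive_subst2 operator_additive)
  have comm: "mult_lam (neg_all w) = neg_all (mult_lam w)" for w
    by (simp add: operator_simps)
  note E_simps = subst2_mult_lam[OF additive_mult_lam additive_neg_all additive_const2, OF comm]
    subst2_mult_mu[OF additive_mult_lam additive_neg_all additive_const2]
    subst2_at_lam[OF additive_mult_lam additive_neg_all additive_const2, OF comm]
    subst2_at_mu[OF additive_mult_lam additive_neg_all additive_const2, OF comm]
    subst2_at_lam_plus_mu[OF additive_mult_lam additive_neg_all additive_const2, OF comm]
  have f: "additive (\<lambda>x. at_lam (\<rho> a x))" "additive (\<lambda>x. at_mu (\<rho> c x))"
    "additive (\<lambda>x. at_lam_plus_mu (\<rho> x m))"
    by (intro additive_comp[OF additive_at(1)] additive_comp[OF additive_at(2)]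
        additive_comp[OF additive_at(3)] additive_rho)+
  have "?E (psubst mult_mu (\<lambda>x. at_lam (\<rho> a x)) (\<rho> c m))
      = psubst neg_all (\<lambda>x. at_lam (\<rho> a x)) (\<rho> c m)"
    by (subst psubst_fusion[OF additive_mult_mu additive_neg_all f(1) E])
      (simp_all add: E_simps, simp add: at_lam_def)
  \<comment> \<open>Regrouping as -(\<partial>+\<lambda>)-\<mu> gives the shape of the composition
    rule with \<open>\<Theta>\<close> = \<partial>+\<lambda>.\<close>
  also have "\<dots> = psubst (\<lambda>w. - (der2 w + mult_lam w) - mult_mu w) (\<lambda>x. at_lam (\<rho> a x)) (\<rho> c m)"
    by (rule arg_cong[where f = "\<lambda>\<Phi>. psubst \<Phi> _ _"]) (simp add: fun_eq_iff)
  also have "\<dots> = psubst mult_mu (\<lambda>x. at_lam (\<rho> a x)) (ader (\<rho> c m))"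
    by (rule psubst_at_minus_der_lam[symmetric])
      (auto intro!: operator_additive f simp: at_rho_der operator_simps)
  finally have 1: "?E (psubst mult_mu (\<lambda>x. at_lam (\<rho> a x)) (\<rho> c m))
      = psubst mult_mu (\<lambda>x. at_lam (\<rho> a x)) (ader (\<rho> c m))" .
  have 2: "?E (psubst mult_lam (\<lambda>x. at_mu (\<rho> c x)) (\<rho> a m))
      = psubst mult_lam (\<lambda>x. at_lam_plus_mu (ader (\<rho> c x))) (\<rho> a m)"
    by (subst psubst_fusion[OF additive_mult_lam additive_mult_lam f(2) E])
      (simp_all add: E_simps at_ader)
  \<comment> \<open>The parameter \<lambda>+\<mu> of \<rho>([a,c]) becomes
    \<lambda>+(-\<partial>-\<lambda>-\<mu>) = -\<partial>-\<mu>.\<close>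
  have "(\<lambda>w. mult_lam w + neg_all w) = (\<lambda>w. - der2 w - mult_mu w)"
    by (simp add: fun_eq_iff)
  then have 3: "?E (psubst mult_lam (\<lambda>x. at_lam_plus_mu (\<rho> x m)) (br a c))
      = psubst mult_lam (\<lambda>x. at_mu (ader (\<rho> x m))) (br a c)"
    by (subst psubst_fusion[OF additive_mult_lam additive_mult_lam f(3) E])
      (simp_all add: E_simps at_ader)
  show ?thesis
    using arg_cong[OF rho_br[OF assms, of m], of ?E]
    by (simp add: additive.diff[OF E] additive_psign_eq[OF E] 1 2 3)
qed

text \<open>The representation identity at \<open>\<lambda> := \<mu>\<close> and \<open>\<mu> := -\<partial> - \<lambda> - \<mu>\<close>.\<close>

lemma rho_br_left:
  assumes "b \<in> gR \<beta>" "c \<in> gR \<gamma>"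
  shows "psubst mult_lam (\<lambda>x. at_mu (\<rho> b x)) (ader (\<rho> c m))
      - psign \<beta> \<gamma> (psubst mult_lam (\<lambda>x. at_lam_plus_mu (ader (\<rho> c x))) (ader (\<rho> b m)))
    = psubst mult_mu (\<lambda>x. at_lam (ader (\<rho> x m))) (br b c)"
proof -
  \<comment> \<open>\<open>?E\<close> replaces \<lambda> by \<mu> and \<mu> by
    -\<partial>-\<lambda>-\<mu>.\<close>
  let ?E = "subst2 mult_mu neg_all const2"
  have E: "additive ?E" by (intro additive_subst2 operator_additive)
  have comm: "mult_mu (neg_all w) = neg_all (mult_mu w)" for w
    by (simp add: operator_simps)
  note E_simps = subst2_mult_lam[OF additive_mult_mu additive_neg_all additive_const2, OF comm]
    subst2_mult_mu[OF additive_mult_mu additive_neg_all additive_const2]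
    subst2_at_lam[OF additive_mult_mu additive_neg_all additive_const2, OF comm]
    subst2_at_mu[OF additive_mult_mu additive_neg_all additive_const2, OF comm]
    subst2_at_lam_plus_mu[OF additive_mult_mu additive_neg_all additive_const2, OF comm]
  have f: "additive (\<lambda>x. at_lam (\<rho> b x))" "additive (\<lambda>x. at_mu (\<rho> c x))"
    "additive (\<lambda>x. at_lam_plus_mu (\<rho> x m))" "additive (\<lambda>x. at_mu (\<rho> b x))"
    "additive (\<lambda>x. at_lam_plus_mu (ader (\<rho> c x)))"
    by (intro additive_comp[OF additive_at(1)] additive_comp[OF additive_at(2)]
        additive_comp[OF additive_at(3)] additive_comp[OF additive_ader] additive_rho)+
  have "?E (psubst mult_mu (\<lambda>x. at_lam (\<rho> b x)) (\<rho> c m))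
      = psubst neg_all (\<lambda>x. at_mu (\<rho> b x)) (\<rho> c m)"
    by (subst psubst_fusion[OF additive_mult_mu additive_neg_all f(1) E])
      (simp_all add: E_simps, simp add: at_mu_def)
  \<comment> \<open>Here the grouping is -(\<partial>+\<mu>)-\<lambda>, because \<rho>(b) is now
    taken at \<mu>.\<close>
  also have "\<dots> = psubst (\<lambda>w. - (der2 w + mult_mu w) - mult_lam w) (\<lambda>x. at_mu (\<rho> b x)) (\<rho> c m)"
    by (rule arg_cong[where f = "\<lambda>\<Phi>. psubst \<Phi> _ _"]) (simp add: fun_eq_iff)
  also have "\<dots> = psubst mult_lam (\<lambda>x. at_mu (\<rho> b x)) (ader (\<rho> c m))"
    by (rule psubst_at_minus_der_lam[symmetric])
      (auto intro!: operator_additive f simp: at_rho_der operator_simps)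
  finally have 1: "?E (psubst mult_mu (\<lambda>x. at_lam (\<rho> b x)) (\<rho> c m))
      = psubst mult_lam (\<lambda>x. at_mu (\<rho> b x)) (ader (\<rho> c m))" .
  \<comment> \<open>Once its parameter is -\<partial>-\<lambda>-\<mu>, \<rho>(c) turns \<partial>
    into -(\<lambda>+\<mu>), which is the \<open>\<Theta>\<close> for the second term.\<close>
  have G_der: "at_lam_plus_mu (ader (\<rho> c (dM x)))
      = - (mult_lam (at_lam_plus_mu (ader (\<rho> c x))) + mult_mu (at_lam_plus_mu (ader (\<rho> c x))))"
    for x
    by (simp add: rho_der_right at_minus_der_lam_sesqui[OF M.additive_der]
        additive.minus[OF additive_at(3)])
      (simp add: at_lam_plus_mu_def psubst_mult_var operator_additive)
  have "?E (psubst mult_lam (\<lambda>x. at_mu (\<rho> c x)) (\<rho> b m))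
      = psubst mult_mu (\<lambda>x. at_lam_plus_mu (ader (\<rho> c x))) (\<rho> b m)"
    by (subst psubst_fusion[OF additive_mult_lam additive_mult_mu f(2) E])
      (simp_all add: E_simps at_ader)
  \<comment> \<open>The variable \<mu> is written as -\<open>\<Theta>\<close>-\<lambda> with
    \<open>\<Theta>\<close> = -(\<lambda>+\<mu>), so that it can be read as -\<partial>-\<lambda>
    inserted into \<rho>(b).\<close>
  also have "\<dots> = psubst (\<lambda>w. - (- (mult_lam w + mult_mu w)) - mult_lam w)
      (\<lambda>x. at_lam_plus_mu (ader (\<rho> c x))) (\<rho> b m)"
    by (rule arg_cong[where f = "\<lambda>\<Phi>. psubst \<Phi> _ _"]) (simp add: fun_eq_iff)
  also have "\<dots> = psubst mult_lam (\<lambda>x. at_lam_plus_mu (ader (\<rho> c x))) (ader (\<rho> b m))"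
    by (rule psubst_at_minus_der_lam[symmetric])
      (auto intro!: operator_additive f simp: G_der operator_simps)
  finally have 2: "?E (psubst mult_lam (\<lambda>x. at_mu (\<rho> c x)) (\<rho> b m))
      = psubst mult_lam (\<lambda>x. at_lam_plus_mu (ader (\<rho> c x))) (ader (\<rho> b m))" .
  have "(\<lambda>w. mult_mu w + neg_all w) = (\<lambda>w. - der2 w - mult_lam w)"
    by (simp add: fun_eq_iff)
  then have 3: "?E (psubst mult_lam (\<lambda>x. at_lam_plus_mu (\<rho> x m)) (br b c))
      = psubst mult_mu (\<lambda>x. at_lam (ader (\<rho> x m))) (br b c)"
    by (subst psubst_fusion[OF additive_mult_lam additive_mult_mu f(3) E])
      (simp_all add: E_simps at_ader)
  show ?thesis
    using arg_cong[OF rho_br[OF assms, of m], of ?E]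
    by (simp add: additive.diff[OF E] additive_psign_eq[OF E] 1 2 3)
qed

interpretation SD: graded_dmodule "sd_scale sR sM" "sd_der dR dM" "sd_gr gR gM"
  by (rule graded_dmodule_sd[OF R.graded_dmodule_axioms M.graded_dmodule_axioms])

section \<open>Bilinearity, grading, sesquilinearity and skew-symmetry of the bracket\<close>

lemma sd_br_hom_eq:
  "sd_br_hom br dM \<rho> \<alpha> \<beta> x y = pair_poly (br (fst x) (fst y))
    (\<rho> (fst x) (snd y) - psign \<beta> \<alpha> (ader (\<rho> (fst y) (snd x))))"
  by (simp add: sd_br_hom_def split: prod.splits)

lemmas sd_br_eq = sd_br_homogeneous[unfolded sd_br_hom_eq]

text \<open>With the sign fixed by \<open>\<alpha>\<close> and \<open>\<beta>\<close>, the formula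
  is biadditive on all pairs, not only on homogeneous ones. This lets it stand under a substitution
  in the Jacobi identity.\<close>

lemma additive_sd_br_hom:
  "additive (\<lambda>x. sd_br_hom br dM \<rho> \<alpha> \<beta> x y)" "additive (sd_br_hom br dM \<rho> \<alpha> \<beta> x)"
  unfolding sd_br_hom_eq[abs_def]
  by (intro additive_pair_poly additive_minus additive_psign additive_comp[OF additive_ader]
      additive_comp[OF additive_br(1)] additive_comp[OF additive_br(2)]
      additive_comp[OF additive_rho(1)] additive_comp[OF additive_rho(2)] additive_proj)+

lemma sd_br_hom_scale:
  "sd_br_hom br dM \<rho> \<alpha> \<beta> (sd_scale sR sM c x) y
    = pscale (sd_scale sR sM) c (sd_br_hom br dM \<rho> \<alpha> \<beta> x y)"
  "sd_br_hom br dM \<rho> \<alpha> \<beta> x (sd_scale sR sM c y)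
    = pscale (sd_scale sR sM) c (sd_br_hom br dM \<rho> \<alpha> \<beta> x y)"
proof -
  have pair: "pscale (sd_scale sR sM) c (pair_poly p q) = pair_poly (pscale sR c p) (pscale sM c q)"
    for p q
    by (rule poly_eqI)
      (simp add: coeff_pscale SD.vector_space_axioms R.vector_space_axioms M.vector_space_axioms
        coeff_pair_poly sd_scale_def)
  have diff: "pscale sM c (p - psign \<beta> \<alpha> q) = pscale sM c p - psign \<beta> \<alpha> (pscale sM c q)" for p q
    by (rule poly_eqI)
      (simp add: coeff_pscale M.vector_space_axioms psign_def M.scale_right_diff_distrib
        M.scale_right_distrib)
  show "sd_br_hom br dM \<rho> \<alpha> \<beta> (sd_scale sR sM c x) y
      = pscale (sd_scale sR sM) c (sd_br_hom br dM \<rho> \<alpha> \<beta> x y)"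
    "sd_br_hom br dM \<rho> \<alpha> \<beta> x (sd_scale sR sM c y)
      = pscale (sd_scale sR sM) c (sd_br_hom br dM \<rho> \<alpha> \<beta> x y)"
    using R.br_linear_left R.br_linear_right rho_linear rho_linear_right
    by (simp_all add: sd_br_hom_eq pair diff sd_scale_def Vector_Spaces.linear_iff
        M.at_minus_der_lam_pscale)
qed

lemma sd_br_linear:
  "Vector_Spaces.linear (sd_scale sR sM) (pscale (sd_scale sR sM)) (\<lambda>x. sd_br gR br dM gM \<rho> x y)"
  "Vector_Spaces.linear (sd_scale sR sM) (pscale (sd_scale sR sM)) (sd_br gR br dM gM \<rho> x)"
proof -
  interpret P: vector_space "pscale (sd_scale sR sM)"
    by (rule vector_space_pscale[OF SD.vector_space_axioms])
  show "Vector_Spaces.linear (sd_scale sR sM) (pscale (sd_scale sR sM)) (\<lambda>x. sd_br gR br dM gM \<rho> x y)"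
    "Vector_Spaces.linear (sd_scale sR sM) (pscale (sd_scale sR sM)) (sd_br gR br dM gM \<rho> x)"
    by (auto simp: Vector_Spaces.linear_iff SD.vector_space_axioms P.vector_space_axioms sd_br_def
        SD.hcomp_add SD.hcomp_scale additive.add[OF additive_sd_br_hom(1)]
        additive.add[OF additive_sd_br_hom(2)] sd_br_hom_scale P.scale_right_distrib)
qed

lemma coeff_rho_gr:
  "r \<in> gR \<alpha> \<Longrightarrow> m \<in> gM \<beta> \<Longrightarrow> coeff (\<rho> r m) n \<in> gM (\<alpha> + \<beta>)"
  using rho_graded[of r \<alpha>] unfolding conformal_linear_def by (metis add.commute)

lemma coeff_sd_br_module_gr:
  assumes "x \<in> sd_gr gR gM \<alpha>" "y \<in> sd_gr gR gM \<beta>"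
  shows "coeff (\<rho> (fst x) (snd y) - psign \<beta> \<alpha> (ader (\<rho> (fst y) (snd x)))) n \<in> gM (\<alpha> + \<beta>)"
proof -
  have "coeff (\<rho> (fst x) (snd y)) n \<in> gM (\<alpha> + \<beta>)"
    using assms by (intro coeff_rho_gr) (auto simp: sd_gr_def)
  moreover have *: "coeff (ader (\<rho> (fst y) (snd x))) n \<in> gM (\<alpha> + \<beta>)"
    using assms coeff_rho_gr[of "fst y" \<beta> "snd x" \<alpha>]
    by (intro M.coeff_at_minus_der_lam_gr) (auto simp: sd_gr_def add.commute)
  moreover have "coeff (psign \<beta> \<alpha> (ader (\<rho> (fst y) (snd x)))) n \<in> gM (\<alpha> + \<beta>)"
    using * M.subspace_neg[OF M.gr_subspace] by (auto simp: psign_def)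
  ultimately show ?thesis
    using M.subspace_diff[OF M.gr_subspace] by simp
qed

lemma sd_br_graded:
  assumes "x \<in> sd_gr gR gM \<alpha>" "y \<in> sd_gr gR gM \<beta>"
  shows "coeff (sd_br gR br dM gM \<rho> x y) n \<in> sd_gr gR gM (\<alpha> + \<beta>)"
  using assms coeff_sd_br_module_gr[OF assms] R.br_graded[of "fst x" \<alpha> "fst y" \<beta>]
  by (auto simp: sd_br_eq coeff_pair_poly sd_gr_def)

lemma sd_C1:
  "sd_br gR br dM gM \<rho> (sd_der dR dM x) y = - mult_var (sd_br gR br dM gM \<rho> x y)"
proof -
  have pair: "mult_var (pair_poly p q) = pair_poly (mult_var p) (mult_var q)"
    "- pair_poly p q = pair_poly (- p) (- q)" for p :: "'a poly" and q :: "'b poly"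
    by (rule poly_eqI;
      simp add: coeff_pair_poly mult_var_def coeff_pCons zero_prod_def split: nat.split)+
  \<comment> \<open>The rule holds for each pair of degrees and arbitrary arguments. It passes to
    the sum over the degrees because \<partial> commutes with taking homogeneous components.\<close>
  have "sd_br_hom br dM \<rho> \<alpha> \<beta> (sd_der dR dM x) y = - mult_var (sd_br_hom br dM \<rho> \<alpha> \<beta> x y)"
    for \<alpha> \<beta> x y
    by (simp add: sd_br_hom_eq sd_der_def pair R.C1 rho_der rho_der_right
        at_minus_der_lam_sesqui[OF M.additive_der] additive.diff[OF additive_mult_var]
        additive_psign_eq[OF additive_mult_var])
      (simp add: psign_def minus_diff_commute)
  then show ?thesis
    by (simp add: sd_br_def SD.hcomp_der additive.add[OF additive_mult_var])
qed

lemma sd_C2: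
  assumes "x \<in> sd_gr gR gM \<alpha>" "y \<in> sd_gr gR gM \<beta>"
  shows "sd_br gR br dM gM \<rho> x y
    = - psign \<alpha> \<beta> (at_minus_der_lam (sd_der dR dM) (sd_br gR br dM gM \<rho> y x))"
proof (rule poly_prod_eqI)
  have xy: "fst x \<in> gR \<alpha>" "fst y \<in> gR \<beta>"
    using assms by (auto simp: sd_gr_def)
  have proj: "map_poly fst (at_minus_der_lam (sd_der dR dM) p) = at_minus_der_lam dR (map_poly fst p)"
    "map_poly snd (at_minus_der_lam (sd_der dR dM) p) = ader (map_poly snd p)" for p
    by (rule map_poly_at_minus_der_lam[OF SD.additive_der R.additive_der additive_proj(1)]
        map_poly_at_minus_der_lam[OF SD.additive_der M.additive_der additive_proj(2)];
      simp add: sd_der_def)+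
  note push = additive.minus[OF additive_map_poly] additive_psign_eq[OF additive_map_poly]
    additive_proj proj sd_br_eq map_poly_pair_poly
  show "map_poly fst (sd_br gR br dM gM \<rho> x y) = map_poly fst
      (- psign \<alpha> \<beta> (at_minus_der_lam (sd_der dR dM) (sd_br gR br dM gM \<rho> y x)))"
    using R.C2[OF xy] assms
    by (simp add: push)
  \<comment> \<open>Exchanging the arguments exchanges the two terms of the module component: one
    acquires the substitution, the other loses it by the involution, and there the sign occurs twice
    and cancels.\<close>
  show "map_poly snd (sd_br gR br dM gM \<rho> x y) = map_poly snd
      (- psign \<alpha> \<beta> (at_minus_der_lam (sd_der dR dM) (sd_br gR br dM gM \<rho> y x)))"
    using assms
    by (simp add: push additive.diff[OF additive_ader]
        additive_psign_eq[OF additive_ader] at_minus_der_lam_involution[OF M.additive_der])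
      (simp add: psign_def mult.commute)
qed

section \<open>The Jacobi identity, component by component\<close>

lemma psubst_sd_br_right:
  fixes \<Xi> :: "('a \<times> 'b) poly \<Rightarrow> ('a \<times> 'b) poly poly"
  assumes "x \<in> sd_gr gR gM \<alpha>" "\<And>n. coeff p n \<in> gR \<epsilon>" "\<And>n. coeff q n \<in> gM \<epsilon>"
    and "additive \<Phi>" "additive \<Phi>\<^sub>1" "additive \<Phi>\<^sub>2" "additive \<Xi>" "additive \<Xi>\<^sub>1" "additive \<Xi>\<^sub>2"
    and "\<And>w. map_poly (map_poly fst) (\<Phi> w) = \<Phi>\<^sub>1 (map_poly (map_poly fst) w)"
    and "\<And>w. map_poly (map_poly snd) (\<Phi> w) = \<Phi>\<^sub>2 (map_poly (map_poly snd) w)"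
    and "\<And>p. map_poly (map_poly fst) (\<Xi> p) = \<Xi>\<^sub>1 (map_poly fst p)"
    and "\<And>p. map_poly (map_poly snd) (\<Xi> p) = \<Xi>\<^sub>2 (map_poly snd p)"
  shows "map_poly (map_poly fst) (psubst \<Phi> (\<lambda>z. \<Xi> (sd_br gR br dM gM \<rho> x z)) (pair_poly p q))
      = psubst \<Phi>\<^sub>1 (\<lambda>z. \<Xi>\<^sub>1 (br (fst x) z)) p" (is ?fst)
    and "map_poly (map_poly snd) (psubst \<Phi> (\<lambda>z. \<Xi> (sd_br gR br dM gM \<rho> x z)) (pair_poly p q))
      = psubst \<Phi>\<^sub>2 (\<lambda>z. \<Xi>\<^sub>2 (\<rho> (fst x) z)) q
        - psign \<epsilon> \<alpha> (psubst \<Phi>\<^sub>2 (\<lambda>z. \<Xi>\<^sub>2 (ader (\<rho> z (snd x)))) p)" (is ?snd)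
proof -
  let ?F = "\<lambda>z. sd_br_hom br dM \<rho> \<alpha> \<epsilon> x z"
  \<comment> \<open>All coefficients have the same degree \<open>\<epsilon>\<close>, so on them the
    bracket is \<open>?F\<close>, which has a constant sign and is additive everywhere.\<close>
  have mem: "coeff (pair_poly p q) n \<in> sd_gr gR gM \<epsilon>" for n
    using assms(2,3) by (simp add: coeff_pair_poly sd_gr_def)
  have F: "psubst \<Phi> (\<lambda>z. \<Xi> (sd_br gR br dM gM \<rho> x z)) (pair_poly p q)
      = psubst \<Phi> (\<lambda>z. \<Xi> (?F z)) (pair_poly p q)"
    by (intro psubst_cong arg_cong[where f = \<Xi>] sd_br_homogeneous assms(1) mem)
  \<comment> \<open>The first component receives nothing from the module part \<open>q\<close>,
    whose contribution is a substitution of the zero map.\<close>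
  have zero: "psubst \<Phi>\<^sub>1 (\<lambda>_. 0) q = 0"
    using assms(5) by (induction q) (simp_all add: psubst_0 psubst_pCons additive.zero additive.intro)
  have "map_poly (map_poly fst) (psubst \<Phi> (\<lambda>z. \<Xi> (?F z)) (pair_poly p q))
      = psubst \<Phi>\<^sub>1 (\<lambda>z. \<Xi>\<^sub>1 (br (fst x) z)) p + psubst \<Phi>\<^sub>1 (\<lambda>_. \<Xi>\<^sub>1 0) q"
    by (rule psubst_at_pair_poly[OF assms(4,5) additive_br(2) additive.intro assms(7,8) additive_proj(1)
          assms(10,12) _ additive_sd_br_hom(2)])
      (simp_all add: sd_br_hom_eq map_poly_pair_poly)
  then show ?fst
    by (simp add: F zero additive.zero[OF assms(8)])
  have ad: "additive (\<lambda>z. ader (\<rho> z (snd x)))"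
    by (intro additive_comp[OF additive_ader] additive_rho)
  have "map_poly (map_poly snd) (psubst \<Phi> (\<lambda>z. \<Xi> (?F z)) (pair_poly p q))
      = psubst \<Phi>\<^sub>2 (\<lambda>z. \<Xi>\<^sub>2 (- psign \<epsilon> \<alpha> (ader (\<rho> z (snd x))))) p
        + psubst \<Phi>\<^sub>2 (\<lambda>z. \<Xi>\<^sub>2 (\<rho> (fst x) z)) q"
    by (rule psubst_at_pair_poly[OF assms(4,6) additive_uminus[OF additive_psign[OF ad]] additive_rho(2)
          assms(7,9) additive_proj(2) assms(11,13) _ additive_sd_br_hom(2)])
      (simp add: sd_br_hom_eq map_poly_pair_poly)
  then show ?snd
    unfolding F
    by (simp add: additive.minus[OF assms(9)] additive_psign_eq[OF assms(9)] psubst_uminus_fun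
        psubst_psign_fun assms additive_psign additive_comp[OF assms(9) ad])
qed

text \<open>The counterpart for an inner bracket standing on the left; here the module part
  \<open>q\<close> carries the sign and the substitution.\<close>

lemma psubst_sd_br_left:
  fixes \<Xi> :: "('a \<times> 'b) poly \<Rightarrow> ('a \<times> 'b) poly poly"
  assumes "x \<in> sd_gr gR gM \<alpha>" "\<And>n. coeff p n \<in> gR \<epsilon>" "\<And>n. coeff q n \<in> gM \<epsilon>"
    and "additive \<Phi>" "additive \<Phi>\<^sub>1" "additive \<Phi>\<^sub>2" "additive \<Xi>" "additive \<Xi>\<^sub>1" "additive \<Xi>\<^sub>2"
    and "\<And>w. map_poly (map_poly fst) (\<Phi> w) = \<Phi>\<^sub>1 (map_poly (map_poly fst) w)"
    and "\<And>w. map_poly (map_poly snd) (\<Phi> w) = \<Phi>\<^sub>2 (map_poly (map_poly snd) w)"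
    and "\<And>p. map_poly (map_poly fst) (\<Xi> p) = \<Xi>\<^sub>1 (map_poly fst p)"
    and "\<And>p. map_poly (map_poly snd) (\<Xi> p) = \<Xi>\<^sub>2 (map_poly snd p)"
  shows "map_poly (map_poly fst) (psubst \<Phi> (\<lambda>z. \<Xi> (sd_br gR br dM gM \<rho> z x)) (pair_poly p q))
      = psubst \<Phi>\<^sub>1 (\<lambda>z. \<Xi>\<^sub>1 (br z (fst x))) p" (is ?fst)
    and "map_poly (map_poly snd) (psubst \<Phi> (\<lambda>z. \<Xi> (sd_br gR br dM gM \<rho> z x)) (pair_poly p q))
      = psubst \<Phi>\<^sub>2 (\<lambda>z. \<Xi>\<^sub>2 (\<rho> z (snd x))) p
        - psign \<alpha> \<epsilon> (psubst \<Phi>\<^sub>2 (\<lambda>z. \<Xi>\<^sub>2 (ader (\<rho> (fst x) z))) q)" (is ?snd)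
proof -
  let ?F = "\<lambda>z. sd_br_hom br dM \<rho> \<epsilon> \<alpha> z x"
  have mem: "coeff (pair_poly p q) n \<in> sd_gr gR gM \<epsilon>" for n
    using assms(2,3) by (simp add: coeff_pair_poly sd_gr_def)
  have F: "psubst \<Phi> (\<lambda>z. \<Xi> (sd_br gR br dM gM \<rho> z x)) (pair_poly p q)
      = psubst \<Phi> (\<lambda>z. \<Xi> (?F z)) (pair_poly p q)"
    by (intro psubst_cong arg_cong[where f = \<Xi>] sd_br_homogeneous assms(1) mem)
  have zero: "psubst \<Phi>\<^sub>1 (\<lambda>_. 0) q = 0"
    using assms(5) by (induction q) (simp_all add: psubst_0 psubst_pCons additive.zero additive.intro)
  have "map_poly (map_poly fst) (psubst \<Phi> (\<lambda>z. \<Xi> (?F z)) (pair_poly p q))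
      = psubst \<Phi>\<^sub>1 (\<lambda>z. \<Xi>\<^sub>1 (br z (fst x))) p + psubst \<Phi>\<^sub>1 (\<lambda>_. \<Xi>\<^sub>1 0) q"
    by (rule psubst_at_pair_poly[OF assms(4,5) additive_br(1) additive.intro assms(7,8) additive_proj(1)
          assms(10,12) _ additive_sd_br_hom(1)])
      (simp_all add: sd_br_hom_eq map_poly_pair_poly)
  then show ?fst
    by (simp add: F zero additive.zero[OF assms(8)])
  have ad: "additive (\<lambda>z. ader (\<rho> (fst x) z))"
    by (intro additive_comp[OF additive_ader] additive_rho)
  have "map_poly (map_poly snd) (psubst \<Phi> (\<lambda>z. \<Xi> (?F z)) (pair_poly p q))
      = psubst \<Phi>\<^sub>2 (\<lambda>z. \<Xi>\<^sub>2 (\<rho> z (snd x))) p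
        + psubst \<Phi>\<^sub>2 (\<lambda>z. \<Xi>\<^sub>2 (- psign \<alpha> \<epsilon> (ader (\<rho> (fst x) z)))) q"
    by (rule psubst_at_pair_poly[OF assms(4,6) additive_rho(1) additive_uminus[OF additive_psign[OF ad]]
          assms(7,9) additive_proj(2) assms(11,13) _ additive_sd_br_hom(1)])
      (simp add: sd_br_hom_eq map_poly_pair_poly)
  then show ?snd
    unfolding F
    by (simp add: additive.minus[OF assms(9)] additive_psign_eq[OF assms(9)] psubst_uminus_fun
        psubst_psign_fun assms additive_psign additive_comp[OF assms(9) ad])
qed

lemma sd_C3:
  assumes a: "a \<in> sd_gr gR gM \<alpha>" and b: "b \<in> sd_gr gR gM \<beta>" and c: "c \<in> sd_gr gR gM \<gamma>"
  shows "psubst mult_mu (\<lambda>x. at_lam (sd_br gR br dM gM \<rho> a x)) (sd_br gR br dM gM \<rho> b c)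
    = psubst mult_lam (\<lambda>x. at_lam_plus_mu (sd_br gR br dM gM \<rho> x c)) (sd_br gR br dM gM \<rho> a b)
      + psign \<alpha> \<beta> (psubst mult_lam (\<lambda>x. at_mu (sd_br gR br dM gM \<rho> b x)) (sd_br gR br dM gM \<rho> a c))"
proof (rule poly_poly_prod_eqI)
  have R: "fst a \<in> gR \<alpha>" "fst b \<in> gR \<beta>" "fst c \<in> gR \<gamma>"
    using a b c by (auto simp: sd_gr_def)
  \<comment> \<open>\<open>bc\<close>, \<open>ac\<close> and \<open>ab\<close> expand the three
    nested brackets and are named after the inner one, whose coefficients are homogeneous of the sum
    of the two degrees.\<close>
  note bc = psubst_sd_br_right[OF a R.br_graded[OF R(2,3)] coeff_sd_br_module_gr[OF b c]
      additive_mult_mu additive_mult_mu additive_mult_mu additive_at(1) additive_at(1) additive_at(1)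
      map_poly_proj_mult_mu map_poly_at(1)[OF additive_proj(1)] map_poly_at(1)[OF additive_proj(2)]]
  note ac = psubst_sd_br_right[OF b R.br_graded[OF R(1,3)] coeff_sd_br_module_gr[OF a c]
      additive_mult_lam additive_mult_lam additive_mult_lam additive_at(2) additive_at(2) additive_at(2)
      map_poly_proj_mult_lam map_poly_at(2)[OF additive_proj(1)] map_poly_at(2)[OF additive_proj(2)]]
  note ab = psubst_sd_br_left[OF c R.br_graded[OF R(1,2)] coeff_sd_br_module_gr[OF a b]
      additive_mult_lam additive_mult_lam additive_mult_lam additive_at(3) additive_at(3) additive_at(3)
      map_poly_proj_mult_lam map_poly_at(3)[OF additive_proj(1)] map_poly_at(3)[OF additive_proj(2)]]
  note br_eq = sd_br_eq[OF a b] sd_br_eq[OF a c] sd_br_eq[OF b c]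
  note pr_add = additive.add[OF additive_map_poly[OF additive_map_poly]]
    additive_psign_eq[OF additive_map_poly[OF additive_map_poly]] additive_proj
  show "map_poly (map_poly fst)
      (psubst mult_mu (\<lambda>x. at_lam (sd_br gR br dM gM \<rho> a x)) (sd_br gR br dM gM \<rho> b c))
    = map_poly (map_poly fst)
      (psubst mult_lam (\<lambda>x. at_lam_plus_mu (sd_br gR br dM gM \<rho> x c)) (sd_br gR br dM gM \<rho> a b)
      + psign \<alpha> \<beta> (psubst mult_lam (\<lambda>x. at_mu (sd_br gR br dM gM \<rho> b x)) (sd_br gR br dM gM \<rho> a c)))"
    unfolding br_eq using R.C3[OF R] by (simp add: pr_add bc ab ac)
  have f: "additive (\<lambda>x. at_lam (\<rho> (fst a) x))" "additive (\<lambda>x. at_mu (\<rho> (fst b) x))"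
    "additive (\<lambda>x. at_lam_plus_mu (ader (\<rho> (fst c) x)))"
    by (intro additive_comp[OF additive_at(1)] additive_comp[OF additive_at(2)]
        additive_comp[OF additive_at(3)] additive_comp[OF additive_ader] additive_rho)+
  note psubst_diff = additive.diff[OF additive_psubst] additive_psign_eq[OF additive_psubst]
    additive_mult_lam additive_mult_mu f
  \<comment> \<open>Read from right to left, the three forms of the representation identity replace
    the terms in \<rho>([a,b]), \<rho>([a,c]) and \<rho>([b,c]), acting on the module parts of
    \<open>c\<close>, \<open>b\<close> and \<open>a\<close>, by differences of double actions. What
    remains cancels up to signs, which are checked for the eight choices of degrees.\<close>
  show "map_poly (map_poly snd)
      (psubst mult_mu (\<lambda>x. at_lam (sd_br gR br dM gM \<rho> a x)) (sd_br gR br dM gM \<rho> b c))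
    = map_poly (map_poly snd)
      (psubst mult_lam (\<lambda>x. at_lam_plus_mu (sd_br gR br dM gM \<rho> x c)) (sd_br gR br dM gM \<rho> a b)
      + psign \<alpha> \<beta> (psubst mult_lam (\<lambda>x. at_mu (sd_br gR br dM gM \<rho> b x)) (sd_br gR br dM gM \<rho> a c)))"
    unfolding br_eq
    by (simp add: pr_add bc ab ac psubst_diff rho_br[OF R(1,2), symmetric]
        rho_br_middle[OF R(1,3), symmetric] rho_br_left[OF R(2,3), symmetric])
      (cases \<alpha>; cases \<beta>; cases \<gamma>; simp add: psign_def)
qed

end

theorem lemma2p19:
  fixes sR :: "complex \<Rightarrow> 'a::ab_group_add \<Rightarrow> 'a"
    and dR :: "'a \<Rightarrow> 'a"
    and gR :: "bit \<Rightarrow> 'a set"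
    and br :: "'a \<Rightarrow> 'a \<Rightarrow> 'a poly"
    and sM :: "complex \<Rightarrow> 'b::ab_group_add \<Rightarrow> 'b"
    and dM :: "'b \<Rightarrow> 'b"
    and gM :: "bit \<Rightarrow> 'b set"
    and \<rho> :: "'a \<Rightarrow> 'b \<Rightarrow> 'b poly"
  assumes "lie_conformal_superalgebra sR dR gR br"
    and "conformal_module sR dR gR br sM dM gM \<rho>"
  shows "lie_conformal_superalgebra (sd_scale sR sM) (sd_der dR dM) (sd_gr gR gM)
           (sd_br gR br dM gM \<rho>)"
proof -
  interpret conformal_module sR dR gR br sM dM gM \<rho> by (rule assms)
  show ?thesis
    by (intro lie_conformal_superalgebra.intro lie_conformal_superalgebra_axioms.intro
        graded_dmodule_sd R.graded_dmodule_axioms M.graded_dmodule_axioms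
        sd_br_linear sd_br_graded sd_C1 sd_C2 sd_C3)
qed

end
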